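(* Let $(y,\lambda)\in\Gamma(\mathcal{V}_0,Y)\times\mathrm{Map}(\mathcal{V},\mathfrak{g}^* )$ be a section-mapping such that $y$ is an admissible regular section. Then $(y,\lambda)$ is critical for the action 1-form $\mathbb{A}_{\mathcal{V}}(\mathcal{L},\Phi)$ if and only if $y$ is an admissible regular critical section (with fixed boundary) for the Lagrange problem with Lagrangian density $\mathcal{L}:J^1Y\to\mathbb{R}$ and constraint submanifold $S=\Phi^{-1}(e)\subset J^1Y$, and $\lambda$ is the multiplier associated to $y$.
   Context: **Complex.** $V$ is an $n$-dimensional abstract cellular complex, $V_k$ its set of $k$-dimensional cells; elements of $V_0$ are vertices, elements of $V_n$ are faces. There is an incidence relation between $k$-cells and $(k+1)$-cells; a cell $\alpha$ is adherent to a cell $\beta$, written $\alpha\prec\beta$, if $\alpha=\beta$ or there is a chain of cells of consecutive dimensions from $\alpha$ to $\beta$, each incident to the next. Each face has finitely many adherent vertices. For $v\in V_0$, $S_v=\{\alpha\in V_n: v\prec\alpha\}$. $\mathcal{V}\subset V_n$ is a finite set of faces and $\mathcal{V}_0=\{v\in V_0: v\prec\alpha \text{ for some }\alpha\in\mathcal{V}\}$. A vertex $v\in\mathcal{V}_0$ is interior ($v\in\operatorname{int}\mathcal{V}$) if $S_v\subset\mathcal{V}$, and frontier ($v\in\operatorname{fr}\mathcal{V}$) otherwise. **Bundles.** $\pi:Y\to V_0$ is a bundle whose fibers $Y_v$ are differentiable manifolds of the same dimension $m$. $J^1Y=\bigsqcup_{\alpha\in V_n}(J^1Y)_\alpha$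 with $(J^1Y)_\alpha=\prod_{v\prec\alpha}Y_v$. $(J^2Y)_v=\prod_{v'}Y_{v'}$, the product over all vertices $v'$ adherent to some face of $S_v$. For $\alpha\in S_v$, $\pi_{v\alpha}:(J^2Y)_v\to(J^1Y)_\alpha$ is the canonical projection. $\Gamma(\mathcal{V}_0,Y)=\prod_{v\in\mathcal{V}_0}Y_v$ is the manifold of sections over $\mathcal{V}_0$. For a section $y$, $(j^1y)(\alpha)=(y(v))_{v\prec\alpha}$ and $(j^2y)(v)=(y(v'))_{v'\prec\alpha\in S_v}$; for $\delta y\in T_y\Gamma(\mathcal{V}_0,Y)=\bigoplus_{v\in\mathcal V_0} T_{y(v)}Y_v$, $(j^1\delta y)(\alpha)=(\delta y(v))_{v\prec\alpha}$. **Lagrangian and constraint.** $\mathcal{L}:J^1Y\to\mathbb{R}$ is a family of smooth functions $\mathcal{L}_\alpha:(J^1Y)_\alpha\to\mathbb{R}$. $G$ is a Lie group with identity $e$, Lie algebra $\mathfrak{g}=T_eG$, and Maurer–Cartan form $\theta_g(D_g)=(L_{g^{-1}})_*D_g\in\mathfrak{g}$. $\Phi:J^1Y\to G$ is a map whose restrictions $\Phi_\alpha=\Phi|_{(J^1Y)_\alpha}$ are differentiable with $e$ a regular value; $S_\alpha=\Phi_\alpha^{-1}(e)$, $S=\bigsqcup_\alpha S_\alpha$. **Admissibility and criticality of sections.** $y\in\Gamma(\mathcal{V}_0,Y)$ is admissible if $(j^1y)(\alpha)\in S_\alpha$ for all $\alpha\in\mathcal{V}$. For $y$ admissible, $\delta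 y\in T_y\Gamma(\mathcal{V}_0,Y)$ is admissible if $(d\Phi_\alpha)_{(j^1y)(\alpha)}(j^1\delta y)(\alpha)=0$ for all $\alpha\in\mathcal{V}$. An admissible $y$ is critical with fixed boundary for the Lagrange problem if the differential at $y$ of $\mathcal{A}_{\mathcal{V}}(\mathcal{L}):y\mapsto\sum_{\alpha\in\mathcal{V}}\mathcal{L}((j^1y)(\alpha))$ vanishes on all admissible $\delta y$ that vanish at every $v\in\operatorname{fr}\mathcal{V}$. Let $T_y^c(\Gamma(\mathcal{V}_0,Y))$ be the space of all $\delta y\in T_y\Gamma(\mathcal{V}_0,Y)$ vanishing at every $v\in\operatorname{fr}\mathcal{V}$. An admissible section $y$ is regular if the linear map $T_y^c(\Gamma(\mathcal{V}_0,Y))\to\mathrm{Map}(\mathcal{V},\mathfrak{g})$, $\delta y\mapsto\big(\alpha\mapsto(\theta\circ d\Phi_\alpha)_{(j^1y)(\alpha)}((j^1\delta y)(\alpha))\big)$, is onto. **Cartan forms and multiplier.** For $v\prec\alpha$, $\Theta_\alpha^v(\Phi)$ is the $\mathfrak{g}$-valued 1-form on $(J^1Y)_\alpha$ that is the component along $Y_v$ of $\theta\circ d\Phi_\alpha$: it sends $X=(X_{v'})_{v'\prec\alpha}$ to $(\theta\circ d\Phi_\alpha)$ applied to the vector with $v$-component $X_v$ and all other components $0$; thus $\theta\circ d\Phi_\alpha=\sum_{v\prec\alpha}\Theta_\alpha^v(\Phi)$. Likewise $\Theta^v_\alpha(\mathcal{L})$ is the component along $Y_v$ of $d\mathcal{L}_\alpha$,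 and $\mathcal{E}_v(\mathcal{L})=\sum_{\alpha\in S_v}\pi_{v\alpha}^*\Theta_\alpha^v(\mathcal{L})$ (Euler–Lagrange 1-form, on $(J^2Y)_v$). Below, $\circ$ between an element of $\mathfrak{g}^*$ and a $\mathfrak{g}$-valued form is the duality pairing. The multiplier associated to a regular admissible critical section $y$ is the unique $\lambda\in\mathrm{Map}(\mathcal{V},\mathfrak{g}^* )$ with $\big(\mathcal{E}_v(\mathcal{L})+\sum_{\alpha\in S_v}\pi_{v\alpha}^*(\lambda(\alpha)\circ\Theta_\alpha^v(\Phi))\big)_{(j^2y)(v)}=0$ for all $v\in\operatorname{int}\mathcal{V}$ (it exists and is unique for such $y$). **Extended problem.** The action 1-form $\mathbb{A}_{\mathcal{V}}(\mathcal{L},\Phi)$ is the 1-form on $\Gamma(\mathcal{V}_0,Y)\times\mathrm{Map}(\mathcal{V},\mathfrak{g}^* )$ given by $$\big(\mathbb{A}_{\mathcal{V}}(\mathcal{L},\Phi)\big)_{(y,\lambda)}(\delta y,\delta\lambda)=\sum_{\alpha\in\mathcal{V}}\Big[(d\mathcal{L}_\alpha)_{(j^1y)(\alpha)}(j^1\delta y)(\alpha)+\lambda(\alpha)\circ(\theta\circ d\Phi_\alpha)_{(j^1y)(\alpha)}(j^1\delta y)(\alpha)\Big].$$ A section-mapping $(y,\lambda)$ is critical for $\mathbb{A}_{\mathcal{V}}(\mathcal{L},\Phi)$ if $y$ is admissible and $(\mathbb{A}_{\mathcal{V}}(\mathcal{L},\Phi))_{(y,\lambda)}$ vanishes on $T_y^c(\Gamma(\mathcal{V}_0,Y))\oplus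 T_\lambda(\mathrm{Map}(\mathcal{V},\mathfrak{g}^* ))$. *)

theory Defs
  imports "HOL-Analysis.Analysis" "HOL-Algebra.Group"
begin

section \<open>Smooth functions on open subsets of coordinate spaces\<close>

text \<open>
  The jet manifolds have a dimension that depends on the face, so dimensions cannot be types here.
  For a finite index set \<open>I\<close> the coordinate space \<open>\<real>\<^sup>I\<close> is the set of extensional functions
  \<open>I \<rightarrow>\<^sub>E UNIV\<close> with the topology \<^term>\<open>powertop_real I\<close>; \<open>I = {}\<close> gives the one-point space.
\<close>

primrec cont_diff_on :: "nat \<Rightarrow> 'i set \<Rightarrow> ('i \<Rightarrow> real) set \<Rightarrow> (('i \<Rightarrow> real) \<Rightarrow> real) \<Rightarrow> bool" where
  "cont_diff_on 0 I U f \<longleftrightarrow>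
     continuous_map (subtopology (powertop_real I) U) euclideanreal f"
| "cont_diff_on (Suc k) I U f \<longleftrightarrow>
     continuous_map (subtopology (powertop_real I) U) euclideanreal f \<and>
     (\<forall>i\<in>I. (\<forall>x\<in>U. (\<lambda>t. f (x(i := t))) differentiable (at (x i))) \<and>
            cont_diff_on k I U (\<lambda>x. deriv (\<lambda>t. f (x(i := t))) (x i)))"

definition smooth_on :: "'i set \<Rightarrow> ('i \<Rightarrow> real) set \<Rightarrow> (('i \<Rightarrow> real) \<Rightarrow> real) \<Rightarrow> bool" where
  "smooth_on I U f \<longleftrightarrow> (\<forall>k. cont_diff_on k I U f)"


section \<open>Smooth manifolds\<close>

text \<open>A chart is a pair of its domain and its coordinate map; the atlas need not be maximal.\<close>

record ('a, 'i) manifold =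
  mtop :: "'a topology"
  mindex :: "'i set"
  matlas :: "('a set \<times> ('a \<Rightarrow> 'i \<Rightarrow> real)) set"

abbreviation points :: "('a, 'i) manifold \<Rightarrow> 'a set" where
  "points M \<equiv> topspace (mtop M)"

definition mdim :: "('a, 'i) manifold \<Rightarrow> nat" where
  "mdim M = card (mindex M)"

definition smooth_manifold :: "('a, 'i) manifold \<Rightarrow> bool" where
  "smooth_manifold M \<longleftrightarrow>
     finite (mindex M) \<and> Hausdorff_space (mtop M) \<and> second_countable (mtop M) \<and>
     (\<Union>(U, \<phi>)\<in>matlas M. U) = points M \<and>
     (\<forall>(U, \<phi>)\<in>matlas M. openin (mtop M) U \<and> openin (powertop_real (mindex M)) (\<phi> ` U) \<and>
        homeomorphic_map (subtopology (mtop M) U) (subtopology (powertop_real (mindex M)) (\<phi> ` U)) \<phi>) \<and>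
     (\<forall>(U, \<phi>)\<in>matlas M. \<forall>(W, \<psi>)\<in>matlas M. \<forall>i\<in>mindex M.
        smooth_on (mindex M) (\<phi> ` (U \<inter> W)) (\<lambda>x. \<psi> (inv_into U \<phi> x) i))"

definition smooth_fun :: "('a, 'i) manifold \<Rightarrow> ('a \<Rightarrow> real) \<Rightarrow> bool" where
  "smooth_fun M f \<longleftrightarrow>
     (\<forall>(U, \<phi>)\<in>matlas M. smooth_on (mindex M) (\<phi> ` U) (\<lambda>x. f (inv_into U \<phi> x)))"

definition smooth_map :: "('a, 'i) manifold \<Rightarrow> ('b, 'j) manifold \<Rightarrow> ('a \<Rightarrow> 'b) \<Rightarrow> bool" where
  "smooth_map M N F \<longleftrightarrow>
     continuous_map (mtop M) (mtop N) F \<and>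
     (\<forall>(U, \<phi>)\<in>matlas M. \<forall>(W, \<psi>)\<in>matlas N. \<forall>j\<in>mindex N.
        smooth_on (mindex M) (\<phi> ` {p\<in>U. F p \<in> W}) (\<lambda>x. \<psi> (F (inv_into U \<phi> x)) j))"

text \<open>Product of finitely many manifolds; its points are the extensional functions on \<open>K\<close>.\<close>

definition product_manifold ::
    "'k set \<Rightarrow> ('k \<Rightarrow> ('a, 'i) manifold) \<Rightarrow> ('k \<Rightarrow> 'a, 'k \<times> 'i) manifold" where
  "product_manifold K M =
     \<lparr> mtop = product_topology (\<lambda>k. mtop (M k)) K,
       mindex = (SIGMA k:K. mindex (M k)),
       matlas = {(PiE K U, \<lambda>p. \<lambda>(k, i)\<in>(SIGMA k:K. mindex (M k)). \<phi> k (p k) i) | U \<phi>.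
                   \<forall>k\<in>K. (U k, \<phi> k) \<in> matlas (M k)} \<rparr>"


section \<open>Tangent vectors and differentials\<close>

text \<open>
  Tangent vectors are derivations of the algebra of smooth functions. Such a derivation depends only
  on the restriction of its argument to \<^term>\<open>points M\<close> (Leibniz rule); it is given the value \<open>0\<close>
  outside the smooth functions, so that distinct functions are distinct tangent vectors and the
  vector space operations are pointwise.
\<close>

type_synonym 'a tangent = "('a \<Rightarrow> real) \<Rightarrow> real"

definition tangent_space :: "('a, 'i) manifold \<Rightarrow> 'a \<Rightarrow> 'a tangent set" where
  "tangent_space M p = {X.
     (\<forall>f. \<not> smooth_fun M f \<longrightarrow> X f = 0) \<and>
     (\<forall>f g a b. smooth_fun M f \<longrightarrow> smooth_fun M g \<longrightarrow>
        X (\<lambda>q. a * f q + b * g q) = a * X f + b * X g) \<and>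
     (\<forall>f g. smooth_fun M f \<longrightarrow> smooth_fun M g \<longrightarrow>
        X (\<lambda>q. f q * g q) = f p * X g + g p * X f)}"

abbreviation zero_tangent :: "'a tangent" where
  "zero_tangent \<equiv> \<lambda>f. 0"

definition differential :: "('b, 'j) manifold \<Rightarrow> ('a \<Rightarrow> 'b) \<Rightarrow> 'a tangent \<Rightarrow> 'b tangent" where
  "differential N F X = (\<lambda>h. if smooth_fun N h then X (\<lambda>q. h (F q)) else 0)"

text \<open>For real-valued functions the tangent spaces of the target are identified with \<open>\<real>\<close>.\<close>

definition differential_real :: "('a \<Rightarrow> real) \<Rightarrow> 'a tangent \<Rightarrow> real" where
  "differential_real f X = X f"

definition regular_value :: "('a, 'i) manifold \<Rightarrow> ('b, 'j) manifold \<Rightarrow> ('a \<Rightarrow> 'b) \<Rightarrow> 'b \<Rightarrow> bool" where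
  "regular_value M N F q \<longleftrightarrow>
     (\<forall>p\<in>points M. F p = q \<longrightarrow> differential N F ` tangent_space M p = tangent_space N q)"

text \<open>
  Elements of \<open>\<Oplus>\<^bsub>k\<in>K\<^esub> T\<^bsub>p(k)\<^esub> M\<^sub>k\<close>, and the canonical isomorphism of this space with the tangent
  space of the product at \<open>p\<close>: it sends \<open>X\<close> to the sum of the push-forwards of the \<open>X k\<close> along the
  inclusions \<open>z \<mapsto> p(k := z)\<close> of the factors.
\<close>

definition tangent_tuples ::
    "'k set \<Rightarrow> ('k \<Rightarrow> ('a, 'i) manifold) \<Rightarrow> ('k \<Rightarrow> 'a) \<Rightarrow> ('k \<Rightarrow> 'a tangent) set" where
  "tangent_tuples K M p = (\<Pi>\<^sub>E k\<in>K. tangent_space (M k) (p k))"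

definition product_tangent ::
    "'k set \<Rightarrow> ('k \<Rightarrow> ('a, 'i) manifold) \<Rightarrow> ('k \<Rightarrow> 'a) \<Rightarrow> ('k \<Rightarrow> 'a tangent) \<Rightarrow> ('k \<Rightarrow> 'a) tangent" where
  "product_tangent K M p X =
     (\<lambda>f. \<Sum>k\<in>K. differential (product_manifold K M) (\<lambda>z. p(k := z)) (X k) f)"

definition tuple_component :: "'k set \<Rightarrow> 'k \<Rightarrow> ('k \<Rightarrow> 'a tangent) \<Rightarrow> 'k \<Rightarrow> 'a tangent" where
  "tuple_component K k X = (\<lambda>k'\<in>K. if k' = k then X k else zero_tangent)"

text \<open>Linear functionals on a space of tangent vectors, extensional on that space.\<close>

definition dual_space :: "'a tangent set \<Rightarrow> ('a tangent \<Rightarrow> real) set" where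
  "dual_space W = {\<xi> \<in> extensional W.
     \<forall>X\<in>W. \<forall>Z\<in>W. \<forall>a b. \<xi> (\<lambda>f. a * X f + b * Z f) = a * \<xi> X + b * \<xi> Z}"


section \<open>Lie groups\<close>

record ('g, 'j) lie_group = "'g monoid" +
  mfd :: "('g, 'j) manifold"

text \<open>The product \<open>G \<times> G\<close> is rendered as the product indexed by \<^typ>\<open>bool\<close>.\<close>

definition lie_group :: "('g, 'j) lie_group \<Rightarrow> bool" where
  "lie_group G \<longleftrightarrow>
     group G \<and> smooth_manifold (mfd G) \<and> points (mfd G) = carrier G \<and>
     smooth_map (product_manifold (UNIV :: bool set) (\<lambda>_. mfd G)) (mfd G)
       (\<lambda>p. p False \<otimes>\<^bsub>G\<^esub> p True) \<and>
     smooth_map (mfd G) (mfd G) (\<lambda>g. inv\<^bsub>G\<^esub> g)"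

definition lie_algebra :: "('g, 'j) lie_group \<Rightarrow> 'g tangent set" where
  "lie_algebra G = tangent_space (mfd G) \<one>\<^bsub>G\<^esub>"

definition maurer_cartan :: "('g, 'j) lie_group \<Rightarrow> 'g \<Rightarrow> 'g tangent \<Rightarrow> 'g tangent" where
  "maurer_cartan G g D = differential (mfd G) (\<lambda>h. inv\<^bsub>G\<^esub> g \<otimes>\<^bsub>G\<^esub> h) D"


section \<open>Cellular complexes\<close>

record 'c cell_complex =
  cdim :: nat
  cells :: "nat \<Rightarrow> 'c set"
  incident :: "'c \<Rightarrow> 'c \<Rightarrow> bool"

definition abstract_cellular_complex :: "'c cell_complex \<Rightarrow> bool" where
  "abstract_cellular_complex C \<longleftrightarrow>
     (\<forall>i j. i \<noteq> j \<longrightarrow> cells C i \<inter> cells C j = {}) \<and>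
     (\<forall>k>cdim C. cells C k = {}) \<and>
     (\<forall>a b. incident C a b \<longrightarrow> (\<exists>k. a \<in> cells C k \<and> b \<in> cells C (Suc k)))"

definition vertices :: "'c cell_complex \<Rightarrow> 'c set" where
  "vertices C = cells C 0"

definition faces :: "'c cell_complex \<Rightarrow> 'c set" where
  "faces C = cells C (cdim C)"

definition adherent :: "'c cell_complex \<Rightarrow> 'c \<Rightarrow> 'c \<Rightarrow> bool" where
  "adherent C = (incident C)\<^sup>*\<^sup>*"

definition face_vertices :: "'c cell_complex \<Rightarrow> 'c \<Rightarrow> 'c set" where
  "face_vertices C \<alpha> = {v \<in> vertices C. adherent C v \<alpha>}"

definition star :: "'c cell_complex \<Rightarrow> 'c \<Rightarrow> 'c set" where
  "star C v = {\<alpha> \<in> faces C. adherent C v \<alpha>}"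

definition star_vertices :: "'c cell_complex \<Rightarrow> 'c \<Rightarrow> 'c set" where
  "star_vertices C v = (\<Union>\<alpha>\<in>star C v. face_vertices C \<alpha>)"

definition domain_vertices :: "'c cell_complex \<Rightarrow> 'c set \<Rightarrow> 'c set" where
  "domain_vertices C \<V> = (\<Union>\<alpha>\<in>\<V>. face_vertices C \<alpha>)"

definition interior_vertices :: "'c cell_complex \<Rightarrow> 'c set \<Rightarrow> 'c set" where
  "interior_vertices C \<V> = {v \<in> domain_vertices C \<V>. star C v \<subseteq> \<V>}"

definition frontier_vertices :: "'c cell_complex \<Rightarrow> 'c set \<Rightarrow> 'c set" where
  "frontier_vertices C \<V> = domain_vertices C \<V> - interior_vertices C \<V>"


section \<open>Jets and sections\<close>

text \<open>
  The bundle is given by its family of fibres \<open>Y v\<close>, the disjoint union \<open>J\<^sup>1Y\<close> by the family of the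
  manifolds \<open>J1 C Y \<alpha>\<close>, and a map on \<open>J\<^sup>1Y\<close> by its restrictions to them.
\<close>

definition J1 :: "'c cell_complex \<Rightarrow> ('c \<Rightarrow> ('y, 'i) manifold) \<Rightarrow> 'c \<Rightarrow> ('c \<Rightarrow> 'y, 'c \<times> 'i) manifold" where
  "J1 C Y \<alpha> = product_manifold (face_vertices C \<alpha>) Y"

definition sections :: "'c cell_complex \<Rightarrow> ('c \<Rightarrow> ('y, 'i) manifold) \<Rightarrow> 'c set \<Rightarrow> ('c \<Rightarrow> 'y, 'c \<times> 'i) manifold" where
  "sections C Y \<V> = product_manifold (domain_vertices C \<V>) Y"

text \<open>Jet prolongations, of sections and of tangent tuples alike.\<close>

definition j1 :: "'c cell_complex \<Rightarrow> ('c \<Rightarrow> 'z) \<Rightarrow> 'c \<Rightarrow> 'c \<Rightarrow> 'z" where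
  "j1 C y \<alpha> = restrict y (face_vertices C \<alpha>)"

definition j2 :: "'c cell_complex \<Rightarrow> ('c \<Rightarrow> 'z) \<Rightarrow> 'c \<Rightarrow> 'c \<Rightarrow> 'z" where
  "j2 C y v = restrict y (star_vertices C v)"

text \<open>
  The projection \<open>(J\<^sup>2Y)\<^sub>v \<rightarrow> (J\<^sup>1Y)\<^sub>\<alpha>\<close> for \<open>\<alpha>\<close> in the star of \<open>v\<close>; on tangent tuples its
  differential is given by the same formula.
\<close>

definition jet_proj :: "'c cell_complex \<Rightarrow> 'c \<Rightarrow> ('c \<Rightarrow> 'z) \<Rightarrow> 'c \<Rightarrow> 'z" where
  "jet_proj C \<alpha> w = restrict w (face_vertices C \<alpha>)"

definition section_tangents ::
    "'c cell_complex \<Rightarrow> ('c \<Rightarrow> ('y, 'i) manifold) \<Rightarrow> 'c set \<Rightarrow> ('c \<Rightarrow> 'y) \<Rightarrow> ('c \<Rightarrow> 'y tangent) set" where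
  "section_tangents C Y \<V> y = tangent_tuples (domain_vertices C \<V>) Y y"

definition boundary_fixing_tangents ::
    "'c cell_complex \<Rightarrow> ('c \<Rightarrow> ('y, 'i) manifold) \<Rightarrow> 'c set \<Rightarrow> ('c \<Rightarrow> 'y) \<Rightarrow> ('c \<Rightarrow> 'y tangent) set" where
  "boundary_fixing_tangents C Y \<V> y =
     {\<delta>y \<in> section_tangents C Y \<V> y. \<forall>v\<in>frontier_vertices C \<V>. \<delta>y v = zero_tangent}"


section \<open>The differentials of the Lagrangian and of the constraint\<close>

text \<open>In this section \<open>u\<close> is a point of \<open>(J\<^sup>1Y)\<^sub>\<alpha>\<close> and \<open>X\<close> a tangent tuple at \<open>u\<close>.\<close>

definition dL ::
    "'c cell_complex \<Rightarrow> ('c \<Rightarrow> ('y, 'i) manifold) \<Rightarrow> ('c \<Rightarrow> ('c \<Rightarrow> 'y) \<Rightarrow> real) \<Rightarrow>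
     'c \<Rightarrow> ('c \<Rightarrow> 'y) \<Rightarrow> ('c \<Rightarrow> 'y tangent) \<Rightarrow> real" where
  "dL C Y \<L> \<alpha> u X = differential_real (\<L> \<alpha>) (product_tangent (face_vertices C \<alpha>) Y u X)"

definition d\<Phi> ::
    "'c cell_complex \<Rightarrow> ('c \<Rightarrow> ('y, 'i) manifold) \<Rightarrow> ('g, 'j) lie_group \<Rightarrow> ('c \<Rightarrow> ('c \<Rightarrow> 'y) \<Rightarrow> 'g) \<Rightarrow>
     'c \<Rightarrow> ('c \<Rightarrow> 'y) \<Rightarrow> ('c \<Rightarrow> 'y tangent) \<Rightarrow> 'g tangent" where
  "d\<Phi> C Y G \<Phi> \<alpha> u X = differential (mfd G) (\<Phi> \<alpha>) (product_tangent (face_vertices C \<alpha>) Y u X)"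

definition \<theta>d\<Phi> ::
    "'c cell_complex \<Rightarrow> ('c \<Rightarrow> ('y, 'i) manifold) \<Rightarrow> ('g, 'j) lie_group \<Rightarrow> ('c \<Rightarrow> ('c \<Rightarrow> 'y) \<Rightarrow> 'g) \<Rightarrow>
     'c \<Rightarrow> ('c \<Rightarrow> 'y) \<Rightarrow> ('c \<Rightarrow> 'y tangent) \<Rightarrow> 'g tangent" where
  "\<theta>d\<Phi> C Y G \<Phi> \<alpha> u X = maurer_cartan G (\<Phi> \<alpha> u) (d\<Phi> C Y G \<Phi> \<alpha> u X)"

definition \<Theta>L ::
    "'c cell_complex \<Rightarrow> ('c \<Rightarrow> ('y, 'i) manifold) \<Rightarrow> ('c \<Rightarrow> ('c \<Rightarrow> 'y) \<Rightarrow> real) \<Rightarrow>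
     'c \<Rightarrow> 'c \<Rightarrow> ('c \<Rightarrow> 'y) \<Rightarrow> ('c \<Rightarrow> 'y tangent) \<Rightarrow> real" where
  "\<Theta>L C Y \<L> v \<alpha> u X = dL C Y \<L> \<alpha> u (tuple_component (face_vertices C \<alpha>) v X)"

definition \<Theta>\<Phi> ::
    "'c cell_complex \<Rightarrow> ('c \<Rightarrow> ('y, 'i) manifold) \<Rightarrow> ('g, 'j) lie_group \<Rightarrow> ('c \<Rightarrow> ('c \<Rightarrow> 'y) \<Rightarrow> 'g) \<Rightarrow>
     'c \<Rightarrow> 'c \<Rightarrow> ('c \<Rightarrow> 'y) \<Rightarrow> ('c \<Rightarrow> 'y tangent) \<Rightarrow> 'g tangent" where
  "\<Theta>\<Phi> C Y G \<Phi> v \<alpha> u X = \<theta>d\<Phi> C Y G \<Phi> \<alpha> u (tuple_component (face_vertices C \<alpha>) v X)"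

text \<open>
  The Euler--Lagrange form at \<open>w \<in> (J\<^sup>2Y)\<^sub>v\<close>, evaluated on a tangent tuple \<open>X\<close>. It is used only at
  interior vertices \<open>v\<close>, whose stars are finite.
\<close>

definition euler_lagrange ::
    "'c cell_complex \<Rightarrow> ('c \<Rightarrow> ('y, 'i) manifold) \<Rightarrow> ('c \<Rightarrow> ('c \<Rightarrow> 'y) \<Rightarrow> real) \<Rightarrow>
     'c \<Rightarrow> ('c \<Rightarrow> 'y) \<Rightarrow> ('c \<Rightarrow> 'y tangent) \<Rightarrow> real" where
  "euler_lagrange C Y \<L> v w X =
     (\<Sum>\<alpha>\<in>star C v. \<Theta>L C Y \<L> v \<alpha> (jet_proj C \<alpha> w) (jet_proj C \<alpha> X))"

definition multiplier_form ::
    "'c cell_complex \<Rightarrow> ('c \<Rightarrow> ('y, 'i) manifold) \<Rightarrow> ('g, 'j) lie_group \<Rightarrow> ('c \<Rightarrow> ('c \<Rightarrow> 'y) \<Rightarrow> 'g) \<Rightarrow>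
     ('c \<Rightarrow> 'g tangent \<Rightarrow> real) \<Rightarrow> 'c \<Rightarrow> ('c \<Rightarrow> 'y) \<Rightarrow> ('c \<Rightarrow> 'y tangent) \<Rightarrow> real" where
  "multiplier_form C Y G \<Phi> lam v w X =
     (\<Sum>\<alpha>\<in>star C v. lam \<alpha> (\<Theta>\<Phi> C Y G \<Phi> v \<alpha> (jet_proj C \<alpha> w) (jet_proj C \<alpha> X)))"


section \<open>The Lagrange problem and the extended problem\<close>

definition constraint_set ::
    "'c cell_complex \<Rightarrow> ('c \<Rightarrow> ('y, 'i) manifold) \<Rightarrow> ('g, 'j) lie_group \<Rightarrow> ('c \<Rightarrow> ('c \<Rightarrow> 'y) \<Rightarrow> 'g) \<Rightarrow>
     'c \<Rightarrow> ('c \<Rightarrow> 'y) set" where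
  "constraint_set C Y G \<Phi> \<alpha> = {u \<in> points (J1 C Y \<alpha>). \<Phi> \<alpha> u = \<one>\<^bsub>G\<^esub>}"

definition admissible_section ::
    "'c cell_complex \<Rightarrow> ('c \<Rightarrow> ('y, 'i) manifold) \<Rightarrow> ('g, 'j) lie_group \<Rightarrow> ('c \<Rightarrow> ('c \<Rightarrow> 'y) \<Rightarrow> 'g) \<Rightarrow>
     'c set \<Rightarrow> ('c \<Rightarrow> 'y) \<Rightarrow> bool" where
  "admissible_section C Y G \<Phi> \<V> y \<longleftrightarrow>
     y \<in> points (sections C Y \<V>) \<and> (\<forall>\<alpha>\<in>\<V>. j1 C y \<alpha> \<in> constraint_set C Y G \<Phi> \<alpha>)"

definition admissible_tangents ::
    "'c cell_complex \<Rightarrow> ('c \<Rightarrow> ('y, 'i) manifold) \<Rightarrow> ('g, 'j) lie_group \<Rightarrow> ('c \<Rightarrow> ('c \<Rightarrow> 'y) \<Rightarrow> 'g) \<Rightarrow>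
     'c set \<Rightarrow> ('c \<Rightarrow> 'y) \<Rightarrow> ('c \<Rightarrow> 'y tangent) set" where
  "admissible_tangents C Y G \<Phi> \<V> y =
     {\<delta>y \<in> section_tangents C Y \<V> y.
        \<forall>\<alpha>\<in>\<V>. d\<Phi> C Y G \<Phi> \<alpha> (j1 C y \<alpha>) (j1 C \<delta>y \<alpha>) = zero_tangent}"

definition action ::
    "'c cell_complex \<Rightarrow> ('c \<Rightarrow> ('c \<Rightarrow> 'y) \<Rightarrow> real) \<Rightarrow> 'c set \<Rightarrow> ('c \<Rightarrow> 'y) \<Rightarrow> real" where
  "action C \<L> \<V> y = (\<Sum>\<alpha>\<in>\<V>. \<L> \<alpha> (j1 C y \<alpha>))"

definition critical_section ::
    "'c cell_complex \<Rightarrow> ('c \<Rightarrow> ('y, 'i) manifold) \<Rightarrow> ('c \<Rightarrow> ('c \<Rightarrow> 'y) \<Rightarrow> real) \<Rightarrow>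
     ('g, 'j) lie_group \<Rightarrow> ('c \<Rightarrow> ('c \<Rightarrow> 'y) \<Rightarrow> 'g) \<Rightarrow> 'c set \<Rightarrow> ('c \<Rightarrow> 'y) \<Rightarrow> bool" where
  "critical_section C Y \<L> G \<Phi> \<V> y \<longleftrightarrow>
     admissible_section C Y G \<Phi> \<V> y \<and>
     (\<forall>\<delta>y \<in> admissible_tangents C Y G \<Phi> \<V> y.
        (\<forall>v\<in>frontier_vertices C \<V>. \<delta>y v = zero_tangent) \<longrightarrow>
        differential_real (action C \<L> \<V>) (product_tangent (domain_vertices C \<V>) Y y \<delta>y) = 0)"

definition regular_section ::
    "'c cell_complex \<Rightarrow> ('c \<Rightarrow> ('y, 'i) manifold) \<Rightarrow> ('g, 'j) lie_group \<Rightarrow> ('c \<Rightarrow> ('c \<Rightarrow> 'y) \<Rightarrow> 'g) \<Rightarrow>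
     'c set \<Rightarrow> ('c \<Rightarrow> 'y) \<Rightarrow> bool" where
  "regular_section C Y G \<Phi> \<V> y \<longleftrightarrow>
     (\<lambda>\<delta>y. \<lambda>\<alpha>\<in>\<V>. \<theta>d\<Phi> C Y G \<Phi> \<alpha> (j1 C y \<alpha>) (j1 C \<delta>y \<alpha>)) ` boundary_fixing_tangents C Y \<V> y
       = (\<V> \<rightarrow>\<^sub>E lie_algebra G)"

definition multipliers :: "('g, 'j) lie_group \<Rightarrow> 'c set \<Rightarrow> ('c \<Rightarrow> 'g tangent \<Rightarrow> real) set" where
  "multipliers G \<V> = (\<V> \<rightarrow>\<^sub>E dual_space (lie_algebra G))"

definition multiplier_of ::
    "'c cell_complex \<Rightarrow> ('c \<Rightarrow> ('y, 'i) manifold) \<Rightarrow> ('c \<Rightarrow> ('c \<Rightarrow> 'y) \<Rightarrow> real) \<Rightarrow>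
     ('g, 'j) lie_group \<Rightarrow> ('c \<Rightarrow> ('c \<Rightarrow> 'y) \<Rightarrow> 'g) \<Rightarrow> 'c set \<Rightarrow> ('c \<Rightarrow> 'y) \<Rightarrow> 'c \<Rightarrow> 'g tangent \<Rightarrow> real" where
  "multiplier_of C Y \<L> G \<Phi> \<V> y = (THE lam. lam \<in> multipliers G \<V> \<and>
     (\<forall>v\<in>interior_vertices C \<V>. \<forall>X\<in>tangent_tuples (star_vertices C v) Y (j2 C y v).
        euler_lagrange C Y \<L> v (j2 C y v) X + multiplier_form C Y G \<Phi> lam v (j2 C y v) X = 0))"

text \<open>
  The set of multipliers is a vector space and hence its own tangent space at every point; the value
  of the action form does not depend on the tangent component \<open>\<delta>lam\<close>.
\<close>

definition action_form ::
    "'c cell_complex \<Rightarrow> ('c \<Rightarrow> ('y, 'i) manifold) \<Rightarrow> ('c \<Rightarrow> ('c \<Rightarrow> 'y) \<Rightarrow> real) \<Rightarrow>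
     ('g, 'j) lie_group \<Rightarrow> ('c \<Rightarrow> ('c \<Rightarrow> 'y) \<Rightarrow> 'g) \<Rightarrow> 'c set \<Rightarrow>
     ('c \<Rightarrow> 'y) \<times> ('c \<Rightarrow> 'g tangent \<Rightarrow> real) \<Rightarrow>
     ('c \<Rightarrow> 'y tangent) \<times> ('c \<Rightarrow> 'g tangent \<Rightarrow> real) \<Rightarrow> real" where
  "action_form C Y \<L> G \<Phi> \<V> = (\<lambda>(y, lam) (\<delta>y, \<delta>lam). \<Sum>\<alpha>\<in>\<V>.
     dL C Y \<L> \<alpha> (j1 C y \<alpha>) (j1 C \<delta>y \<alpha>) +
     lam \<alpha> (\<theta>d\<Phi> C Y G \<Phi> \<alpha> (j1 C y \<alpha>) (j1 C \<delta>y \<alpha>)))"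

definition critical_for_action_form ::
    "'c cell_complex \<Rightarrow> ('c \<Rightarrow> ('y, 'i) manifold) \<Rightarrow> ('c \<Rightarrow> ('c \<Rightarrow> 'y) \<Rightarrow> real) \<Rightarrow>
     ('g, 'j) lie_group \<Rightarrow> ('c \<Rightarrow> ('c \<Rightarrow> 'y) \<Rightarrow> 'g) \<Rightarrow> 'c set \<Rightarrow>
     ('c \<Rightarrow> 'y) \<times> ('c \<Rightarrow> 'g tangent \<Rightarrow> real) \<Rightarrow> bool" where
  "critical_for_action_form C Y \<L> G \<Phi> \<V> = (\<lambda>(y, lam).
     admissible_section C Y G \<Phi> \<V> y \<and>
     (\<forall>(\<delta>y, \<delta>lam) \<in> boundary_fixing_tangents C Y \<V> y \<times> multipliers G \<V>.
        action_form C Y \<L> G \<Phi> \<V> (y, lam) (\<delta>y, \<delta>lam) = 0))"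

end

theory Submission
  imports Defs
begin

text \<open>
  Vanishing of the action form on the tangent tuples that fix the boundary can be tested on tuples
  supported at one interior vertex, where it reads as the Euler--Lagrange equation with multiplier.
  Regularity makes the constraint map onto, so the multiplier is unique, and it exists as soon as
  the differential of the action vanishes on the kernel of the constraint map, that is, on the
  admissible tangent tuples. The chain rule is never needed: regularity already places the values of
  the constraint form in the Lie algebra, and the action is a sum of pullbacks along coordinate maps.
\<close>

section \<open>Differentiability along coordinate maps\<close>

text \<open>Tangent vectors are derivations with default value 0 on functions that are not smooth.
  Evaluating one on the action therefore presupposes that the action is smooth on the section
  manifold and that each of its terms is smooth in one fibre at a time; the material on charts
  serves this. The maps involved, inclusion of a factor and restriction to the vertices of a face,
  merely copy, freeze or drop chart coordinates, so a partial derivative of a pullback is again a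
  pullback or is zero, and induction on the order of differentiability goes through. A second
  obstacle is that regularity is stated with the Maurer-Cartan form and admissibility without it. At
  the jets of an admissible section the two agree, because \<Phi> has the value e there. But left
  translation by the inverse of e is the identity on the carrier only, so derivations must be shown
  blind to values off the manifold.\<close>

lemma update_in_open_eventually:
  assumes "openin (powertop_real I) U" "x \<in> U" "i \<in> I"
  shows "\<forall>\<^sub>F t in nhds (x i). x(i := t) \<in> U"
proof -
  have x: "x \<in> (\<Pi>\<^sub>E j\<in>I. UNIV)"
    using assms openin_subset by fastforce
  have "continuous_map euclideanreal (powertop_real I) (\<lambda>t. x(i := t))"
    using x assms(3) by (auto simp: continuous_map_componentwise extensional_def PiE_def)
  then have "openin euclideanreal {t \<in> topspace euclideanreal. x(i := t) \<in> U}"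
    using assms(1) by (rule openin_continuous_map_preimage)
  then have "open {t. x(i := t) \<in> U}"
    by simp
  then have "\<forall>\<^sub>F t in nhds (x i). t \<in> {t. x(i := t) \<in> U}"
    by (rule eventually_nhds_in_open) (use assms(2) in simp)
  then show ?thesis by simp
qed

text \<open>The definition differentiates along coordinate lines, which may leave \<open>U\<close>,
  while \<open>f\<close> and \<open>g\<close> are compared on \<open>U\<close> only. Openness keeps
  the line in \<open>U\<close> for parameters near \<open>x i\<close>, and a derivative sees no more
  than that.\<close>

lemma cont_diff_on_cong:
  assumes "openin (powertop_real I) U"
    and "cont_diff_on k I U f" "\<And>x. x \<in> U \<Longrightarrow> f x = g x"
  shows "cont_diff_on k I U g"
  using assms(2,3)
proof (induction k arbitrary: f g)
  case 0
  then show ?case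
    by (auto elim: continuous_map_eq)
next
  case (Suc k)
  have ev: "\<forall>\<^sub>F t in nhds (x i). f (x(i := t)) = g (x(i := t))" if "x \<in> U" "i \<in> I" for x i
    using update_in_open_eventually[OF assms(1) that] by eventually_elim (rule Suc.prems)
  have "(\<lambda>t. g (x(i := t))) differentiable (at (x i))" if "x \<in> U" "i \<in> I" for x i
  proof -
    have "(\<lambda>t. f (x(i := t))) differentiable (at (x i))"
      using Suc.prems(1) that by simp
    then obtain d where "((\<lambda>t. f (x(i := t))) has_field_derivative d) (at (x i))"
      using real_differentiable_def by blast
    then have "((\<lambda>t. g (x(i := t))) has_field_derivative d) (at (x i))"
      using DERIV_cong_ev[OF refl ev[OF that] refl] by blast
    then show ?thesis
      using real_differentiable_def by blast
  qed
  moreover have "cont_diff_on k I U (\<lambda>x. deriv (\<lambda>t. g (x(i := t))) (x i))" if "i \<in> I" for i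
  proof (rule Suc.IH[of "\<lambda>x. deriv (\<lambda>t. f (x(i := t))) (x i)"])
    show "cont_diff_on k I U (\<lambda>x. deriv (\<lambda>t. f (x(i := t))) (x i))"
      using Suc.prems(1) that by simp
  qed (rule deriv_cong_ev[OF ev[OF _ that] refl])
  moreover have "continuous_map (subtopology (powertop_real I) U) euclideanreal g"
    using Suc.prems by (auto elim: continuous_map_eq)
  ultimately show ?case by simp
qed

lemma cont_diff_on_const: "cont_diff_on k I U (\<lambda>x. c)"
  by (induction k arbitrary: c) auto

lemma cont_diff_on_add:
  assumes "openin (powertop_real I) U"
    and "cont_diff_on k I U f" "cont_diff_on k I U g"
  shows "cont_diff_on k I U (\<lambda>x. f x + g x)"
  using assms(2,3)
proof (induction k arbitrary: f g)
  case 0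
  then show ?case by (auto intro: continuous_map_add)
next
  case (Suc k)
  have "cont_diff_on k I U (\<lambda>x. deriv (\<lambda>t. f (x(i := t)) + g (x(i := t))) (x i))" if "i \<in> I" for i
  \<comment> \<open>The induction hypothesis yields the sum of the derivatives, the goal asks for
    the derivative of the sum. The two are known to agree at points of \<open>U\<close>, where both
    summands are differentiable.\<close>
  proof (rule cont_diff_on_cong[OF assms(1) Suc.IH[of "\<lambda>x. deriv (\<lambda>t. f (x(i := t))) (x i)"
          "\<lambda>x. deriv (\<lambda>t. g (x(i := t))) (x i)"]])
    fix x assume "x \<in> U"
    then have "(\<lambda>t. f (x(i := t))) differentiable (at (x i))"
      "(\<lambda>t. g (x(i := t))) differentiable (at (x i))"
      using Suc.prems that by simp_all
    then have "(\<lambda>t. f (x(i := t))) field_differentiable (at (x i))"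
      "(\<lambda>t. g (x(i := t))) field_differentiable (at (x i))"
      unfolding real_differentiable_def field_differentiable_def by this
    then show "deriv (\<lambda>t. f (x(i := t))) (x i) + deriv (\<lambda>t. g (x(i := t))) (x i)
        = deriv (\<lambda>t. f (x(i := t)) + g (x(i := t))) (x i)"
      by simp
  qed (use Suc.prems that in auto)
  then show ?case
    using Suc.prems by (auto intro: continuous_map_add)
qed

text \<open>Stands in for the chain rule. Moving one source coordinate either moves exactly one
  target coordinate, at unit speed, or moves nothing. Hence a partial derivative of the pullback is
  the pullback of a partial derivative or zero, and the induction meets no products of
  derivatives.\<close>

lemma cont_diff_on_coordinate_pullback:
  assumes \<rho>: "continuous_map (subtopology (powertop_real I) U) (subtopology (powertop_real J) W) \<rho>"
    and coord: "\<And>i. i \<in> I \<Longrightarrow> (\<exists>j\<in>J. \<forall>x t. \<rho> (x(i := t)) = (\<rho> x)(j := t) \<and> \<rho> x j = x i) \<or>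
      (\<forall>x t. \<rho> (x(i := t)) = \<rho> x)"
    and "U \<subseteq> (\<Pi>\<^sub>E i\<in>I. UNIV)"
    and "cont_diff_on k J W f"
  shows "cont_diff_on k I U (\<lambda>x. f (\<rho> x))"
  using assms(4)
proof (induction k arbitrary: f)
  case 0
  then show ?case
    using continuous_map_compose[OF \<rho>] by (simp add: comp_def)
next
  case (Suc k)
  have W: "\<rho> x \<in> W" if "x \<in> U" for x
    using \<rho> that assms(3) by (auto simp: continuous_map_def)
  have "(\<forall>x\<in>U. (\<lambda>t. f (\<rho> (x(i := t)))) differentiable (at (x i))) \<and>
      cont_diff_on k I U (\<lambda>x. deriv (\<lambda>t. f (\<rho> (x(i := t)))) (x i))" if "i \<in> I" for i
    using coord[OF that]
  proof (elim disjE bexE)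
    fix j assume j: "j \<in> J" "\<forall>x t. \<rho> (x(i := t)) = (\<rho> x)(j := t) \<and> \<rho> x j = x i"
    have "(\<lambda>t. f (\<rho> (x(i := t)))) differentiable (at (x i))" if "x \<in> U" for x
    proof -
      have "(\<lambda>t. f ((\<rho> x)(j := t))) differentiable (at (\<rho> x j))"
        using Suc.prems j(1) W[OF that] by auto
      then show ?thesis using j by simp
    qed
    moreover have "cont_diff_on k I U (\<lambda>x. deriv (\<lambda>t. f ((\<rho> x)(j := t))) (\<rho> x j))"
      using Suc.prems j(1) Suc.IH[of "\<lambda>x. deriv (\<lambda>t. f (x(j := t))) (x j)"] by auto
    ultimately show ?thesis using j(2) by simp
  next
    assume "\<forall>x t. \<rho> (x(i := t)) = \<rho> x"
    then show ?thesis by (simp add: cont_diff_on_const)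
  qed
  moreover have "continuous_map (subtopology (powertop_real I) U) euclideanreal (\<lambda>x. f (\<rho> x))"
    using continuous_map_compose[OF \<rho>, of euclideanreal f] Suc.prems by (simp add: comp_def)
  ultimately show ?case by simp
qed

section \<open>Charts and smooth functions on products\<close>

text \<open>The part of \<^const>\<open>smooth_manifold\<close> that is used; unlike the latter it is easily inherited by products.\<close>

definition charted :: "('a, 'i) manifold \<Rightarrow> bool" where
  "charted M \<longleftrightarrow> (\<Union>(U, \<phi>)\<in>matlas M. U) = points M \<and>
     (\<forall>(U, \<phi>)\<in>matlas M. inj_on \<phi> U \<and> openin (powertop_real (mindex M)) (\<phi> ` U))"

lemma smooth_manifold_charted:
  assumes "smooth_manifold M"
  shows "charted M"
proof -
  have "inj_on \<phi> U \<and> openin (powertop_real (mindex M)) (\<phi> ` U)" if "(U, \<phi>) \<in> matlas M" for U \<phi>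
  proof -
    have *: "openin (mtop M) U" "openin (powertop_real (mindex M)) (\<phi> ` U)"
      "homeomorphic_map (subtopology (mtop M) U) (subtopology (powertop_real (mindex M)) (\<phi> ` U)) \<phi>"
      using assms that by (auto simp: smooth_manifold_def)
    have "inj_on \<phi> (topspace (subtopology (mtop M) U))"
      using *(3) by (simp only: homeomorphic_eq_everything_map)
    moreover have "topspace (subtopology (mtop M) U) = U"
      using *(1) openin_subset by fastforce
    ultimately show ?thesis using *(2) by simp
  qed
  then show ?thesis
    using assms by (auto simp: smooth_manifold_def charted_def)
qed

lemma chart_in:
  assumes "charted M" "(U, \<phi>) \<in> matlas M"
  shows "U \<subseteq> points M" "inj_on \<phi> U" "openin (powertop_real (mindex M)) (\<phi> ` U)"
  using assms by (auto simp: charted_def)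

lemma chartedI:
  assumes "\<And>U \<phi>. (U, \<phi>) \<in> matlas M \<Longrightarrow>
      inj_on \<phi> U \<and> openin (powertop_real (mindex M)) (\<phi> ` U) \<and> U \<subseteq> points M"
    and "\<And>p. p \<in> points M \<Longrightarrow> \<exists>U \<phi>. (U, \<phi>) \<in> matlas M \<and> p \<in> U"
  shows "charted M"
proof -
  have "(\<Union>(U, \<phi>)\<in>matlas M. U) = points M"
    using assms by (intro equalityI subsetI) (blast, force)
  then show ?thesis
    using assms(1) by (auto simp: charted_def)
qed

lemma charted_obtain:
  assumes "charted M" "p \<in> points M"
  obtains U \<phi> where "(U, \<phi>) \<in> matlas M" "p \<in> U"
  using assms unfolding charted_def by blast

lemma smooth_fun_cong:
  assumes "charted M" "\<And>p. p \<in> points M \<Longrightarrow> f p = g p"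
  shows "smooth_fun M f \<longleftrightarrow> smooth_fun M g"
proof -
  have *: "smooth_fun M g" if f: "smooth_fun M f" and eq: "\<And>p. p \<in> points M \<Longrightarrow> f p = g p" for f g
    unfolding smooth_fun_def smooth_on_def
  proof (clarify, rule cont_diff_on_cong)
    fix U \<phi> k assume "(U, \<phi>) \<in> matlas M"
    note c = this chart_in[OF assms(1) this]
    show "openin (powertop_real (mindex M)) (\<phi> ` U)" by fact
    show "cont_diff_on k (mindex M) (\<phi> ` U) (\<lambda>x. f (inv_into U \<phi> x))"
      using f c(1) by (auto simp: smooth_fun_def smooth_on_def)
    show "f (inv_into U \<phi> x) = g (inv_into U \<phi> x)" if "x \<in> \<phi> ` U" for x
      using eq c(2) inv_into_into[OF that] by blast
  qed
  show ?thesis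
    using *[of f g] *[of g f] assms(2) by auto
qed

lemma smooth_fun_const: "smooth_fun M (\<lambda>q. c)"
  by (auto simp: smooth_fun_def smooth_on_def cont_diff_on_const)

lemma smooth_fun_add:
  assumes "charted M" "smooth_fun M f" "smooth_fun M g"
  shows "smooth_fun M (\<lambda>q. f q + g q)"
  using assms(2,3) chart_in(3)[OF assms(1)]
  by (auto simp: smooth_fun_def smooth_on_def intro!: cont_diff_on_add)

lemma smooth_fun_sum:
  assumes "charted M" "\<And>a. a \<in> A \<Longrightarrow> smooth_fun M (f a)"
  shows "smooth_fun M (\<lambda>q. \<Sum>a\<in>A. f a q)"
  using assms(2)
  by (induction A rule: infinite_finite_induct)
    (auto intro!: smooth_fun_const smooth_fun_add[OF assms(1)])

lemma product_manifold_simps: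
  "mtop (product_manifold K M) = product_topology (\<lambda>k. mtop (M k)) K"
  "mindex (product_manifold K M) = (SIGMA k:K. mindex (M k))"
  "matlas (product_manifold K M) =
     {(PiE K U, \<lambda>p. \<lambda>(k, i)\<in>(SIGMA k:K. mindex (M k)). \<phi> k (p k) i) | U \<phi>.
       \<forall>k\<in>K. (U k, \<phi> k) \<in> matlas (M k)}"
  by (simp_all add: product_manifold_def)

text \<open>The image of a chart is open in \<open>powertop_real\<close>, whose points are
  extensional. This allows coordinate vectors to be compared entry by entry on
  \<open>mindex M\<close>.\<close>

lemma chart_coordinates_extensional:
  assumes "charted M" "(U, \<phi>) \<in> matlas M" "p \<in> U"
  shows "\<phi> p \<in> extensional (mindex M)"
  using openin_subset[OF chart_in(3)[OF assms(1,2)]] assms(3)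
  by (force simp: PiE_def)

text \<open>Each factor owns a block of coordinates, and the image of the product chart is described
  by one condition per block. Every condition is the preimage of an open set under a continuous
  block projection, and finitely many of them intersect in an open set.\<close>

lemma product_chart:
  assumes "finite K" "\<And>k. k \<in> K \<Longrightarrow> charted (M k)" "\<forall>k\<in>K. (U k, \<phi> k) \<in> matlas (M k)"
  defines "\<kappa> \<equiv> (\<lambda>p. \<lambda>(k, i)\<in>(SIGMA k:K. mindex (M k)). \<phi> k (p k) i)"
  shows "inj_on \<kappa> (PiE K U)"
    and "openin (powertop_real (SIGMA k:K. mindex (M k))) (\<kappa> ` PiE K U)"
proof -
  let ?S = "SIGMA k:K. mindex (M k)"
  show inj: "inj_on \<kappa> (PiE K U)"
  proof (rule inj_onI)
    fix p q assume pq: "p \<in> PiE K U" "q \<in> PiE K U" "\<kappa> p = \<kappa> q"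
    have "p k = q k" if k: "k \<in> K" for k
    proof -
      have mem: "(U k, \<phi> k) \<in> matlas (M k)" "p k \<in> U k" "q k \<in> U k"
        using assms(3) k pq by auto
      have "\<phi> k (p k) i = \<phi> k (q k) i" if "i \<in> mindex (M k)" for i
        using fun_cong[OF pq(3), of "(k, i)"] that k by (simp add: \<kappa>_def)
      then have "\<phi> k (p k) = \<phi> k (q k)"
        using chart_coordinates_extensional[OF assms(2)[OF k] mem(1)] mem(2,3)
        by (intro extensionalityI[of _ "mindex (M k)"]) auto
      then show ?thesis
        using chart_in(2)[OF assms(2)[OF k] mem(1)] mem(2,3) by (auto dest: inj_onD)
    qed
    then show "p = q" using pq by (intro PiE_ext) auto
  qed
  let ?R = "\<lambda>k x. \<lambda>i\<in>mindex (M k). x (k, i)"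
  \<comment> \<open>\<open>?R k\<close> extracts block \<open>k\<close>. The whole coordinate space
    is kept as a separate term of the intersection because for \<open>K = {}\<close> the indexed
    intersection would be all of UNIV.\<close>
  have eq: "\<kappa> ` PiE K U = (\<Pi>\<^sub>E s\<in>?S. UNIV) \<inter> (\<Inter>k\<in>K. {x \<in> \<Pi>\<^sub>E s\<in>?S. UNIV. ?R k x \<in> \<phi> k ` U k})"
  proof (intro equalityI subsetI)
    fix x assume "x \<in> \<kappa> ` PiE K U"
    then obtain p where p: "p \<in> PiE K U" "x = \<kappa> p" by blast
    have "?R k x = \<phi> k (p k)" if k: "k \<in> K" for k
      using p k chart_coordinates_extensional[OF assms(2)[OF k], of "U k" "\<phi> k" "p k"] assms(3)
      by (intro extensionalityI[of _ "mindex (M k)"]) (auto simp: \<kappa>_def)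
    then show "x \<in> (\<Pi>\<^sub>E s\<in>?S. UNIV) \<inter> (\<Inter>k\<in>K. {x \<in> \<Pi>\<^sub>E s\<in>?S. UNIV. ?R k x \<in> \<phi> k ` U k})"
      using p by (auto simp: \<kappa>_def)
  next
    fix x assume x: "x \<in> (\<Pi>\<^sub>E s\<in>?S. UNIV) \<inter> (\<Inter>k\<in>K. {x \<in> \<Pi>\<^sub>E s\<in>?S. UNIV. ?R k x \<in> \<phi> k ` U k})"
    then have "\<forall>k\<in>K. \<exists>q. q \<in> U k \<and> ?R k x = \<phi> k q" by blast
    then obtain q where q: "\<And>k. k \<in> K \<Longrightarrow> q k \<in> U k \<and> ?R k x = \<phi> k (q k)" by metis
    have "\<kappa> (restrict q K) = x"
    proof
      fix s show "\<kappa> (restrict q K) s = x s"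
      proof (cases "s \<in> ?S")
        case True
        then obtain k i where s: "s = (k, i)" "k \<in> K" "i \<in> mindex (M k)" by blast
        then have "x (k, i) = \<phi> k (q k) i"
          using fun_cong[OF conjunct2[OF q[OF s(2)]], of i] by simp
        then show ?thesis using s by (simp add: \<kappa>_def)
      next
        case False
        then show ?thesis
          using PiE_arb[of x ?S "\<lambda>_. UNIV" s] x by (cases s) (auto simp: \<kappa>_def)
      qed
    qed
    moreover have "restrict q K \<in> PiE K U" using q by auto
    ultimately show "x \<in> \<kappa> ` PiE K U" by blast
  qed
  have "openin (powertop_real ?S) {x \<in> \<Pi>\<^sub>E s\<in>?S. UNIV. ?R k x \<in> \<phi> k ` U k}" if k: "k \<in> K" for k
  proof -
    have "continuous_map (powertop_real ?S) (powertop_real (mindex (M k))) (?R k)"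
      using k by (auto simp: continuous_map_componentwise intro!: continuous_map_product_projection)
    from openin_continuous_map_preimage[OF this] chart_in(3)[OF assms(2)[OF k]] assms(3) k
    show ?thesis by auto
  qed
  moreover have "openin (powertop_real ?S) (\<Pi>\<^sub>E s\<in>?S. UNIV)"
    using openin_topspace[of "powertop_real ?S"] by simp
  ultimately show "openin (powertop_real ?S) (\<kappa> ` PiE K U)"
    unfolding eq using assms(1)
    by (cases "K = {}") (auto intro!: openin_Int openin_INT2)
qed

lemma product_charts_at:
  assumes "\<And>k. k \<in> K \<Longrightarrow> charted (M k)" "p \<in> points (product_manifold K M)"
  obtains U \<phi> where "\<And>k. k \<in> K \<Longrightarrow> (U k, \<phi> k) \<in> matlas (M k) \<and> p k \<in> U k"
proof -
  have "\<exists>U \<phi>. (U, \<phi>) \<in> matlas (M k) \<and> p k \<in> U" if "k \<in> K" for k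
  proof -
    have "p k \<in> points (M k)"
      using assms(2) that by (simp add: product_manifold_simps PiE_iff)
    then show ?thesis
      using charted_obtain[OF assms(1)[OF that]] by metis
  qed
  then show ?thesis
    using that by metis
qed

lemma product_chart_in_atlas:
  assumes "\<forall>k\<in>K. (U k, \<phi> k) \<in> matlas (M k)"
  shows "(PiE K U, \<lambda>p. \<lambda>(k, i)\<in>(SIGMA k:K. mindex (M k)). \<phi> k (p k) i)
    \<in> matlas (product_manifold K M)"
  unfolding product_manifold_simps
  by (intro CollectI exI[of _ U] exI[of _ \<phi>] conjI refl assms)

lemma charted_product_manifold:
  assumes "finite K" "\<And>k. k \<in> K \<Longrightarrow> charted (M k)"
  shows "charted (product_manifold K M)"
proof -
  let ?P = "product_manifold K M"
  have "inj_on \<kappa> W \<and> openin (powertop_real (mindex ?P)) (\<kappa> ` W) \<and> W \<subseteq> points ?P"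
    if "(W, \<kappa>) \<in> matlas ?P" for W \<kappa>
  proof -
    from that obtain U \<phi> where at: "\<forall>k\<in>K. (U k, \<phi> k) \<in> matlas (M k)" and
      W: "W = PiE K U" "\<kappa> = (\<lambda>p. \<lambda>(k, i)\<in>(SIGMA k:K. mindex (M k)). \<phi> k (p k) i)"
      by (auto simp: product_manifold_simps)
    have "U k \<subseteq> points (M k)" if "k \<in> K" for k
      using chart_in(1)[OF assms(2)[OF that]] at that by blast
    then have "W \<subseteq> points ?P"
      unfolding W(1) product_manifold_simps topspace_product_topology by (rule PiE_mono)
    then show ?thesis
      using product_chart[OF assms at] by (simp add: W product_manifold_simps(2))
  qed
  moreover have "\<exists>W \<kappa>. (W, \<kappa>) \<in> matlas ?P \<and> p \<in> W" if p: "p \<in> points ?P" for p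
  proof -
    obtain U \<phi> where U: "\<And>k. k \<in> K \<Longrightarrow> (U k, \<phi> k) \<in> matlas (M k) \<and> p k \<in> U k"
      using product_charts_at[OF assms(2) p] by metis
    have "p \<in> extensional K"
      using p by (simp add: product_manifold_simps PiE_iff)
    then have "p \<in> PiE K U"
      using U by (simp add: PiE_iff)
    moreover have "(PiE K U, \<lambda>p. \<lambda>(k, i)\<in>(SIGMA k:K. mindex (M k)). \<phi> k (p k) i) \<in> matlas ?P"
      using U by (intro product_chart_in_atlas) blast
    ultimately show ?thesis by blast
  qed
  ultimately show ?thesis
    by (intro chartedI) blast+
qed

section \<open>Pullback along inclusions of factors and along restrictions to subproducts\<close>

text \<open>In charts the inclusion copies the coordinates of \<open>z\<close> into block
  \<open>k\<close> and freezes the remaining blocks at those of \<open>p\<close>. With this a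
  derivation at \<open>p k\<close> can be applied to the restriction of \<open>f\<close> to one
  factor without falling back to the default value.\<close>

lemma smooth_fun_factor_inclusion:
  assumes K: "\<And>k. k \<in> K \<Longrightarrow> charted (M k)"
    and fin: "finite K"
    and p: "p \<in> points (product_manifold K M)" and k: "k \<in> K"
    and f: "smooth_fun (product_manifold K M) f"
  shows "smooth_fun (M k) (\<lambda>z. f (p(k := z)))"
  unfolding smooth_fun_def smooth_on_def
proof clarify
  fix U0 \<phi>0 d assume chart0: "(U0, \<phi>0) \<in> matlas (M k)"
  obtain U' \<phi>' where U': "\<And>l. l \<in> K \<Longrightarrow> (U' l, \<phi>' l) \<in> matlas (M l) \<and> p l \<in> U' l"
    using product_charts_at[OF K p] by metis
  \<comment> \<open>The chart under test replaces the one chosen around \<open>p k\<close>, so that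
    the product chart contains the image of all of \<open>U0\<close>.\<close>
  define U where "U = U'(k := U0)"
  define \<phi> where "\<phi> = \<phi>'(k := \<phi>0)"
  have at: "\<forall>l\<in>K. (U l, \<phi> l) \<in> matlas (M l)"
    using U' chart0 by (auto simp: U_def \<phi>_def)
  let ?S = "SIGMA l:K. mindex (M l)"
  define \<kappa> where "\<kappa> = (\<lambda>q. \<lambda>(l, i)\<in>?S. \<phi> l (q l) i)"
  \<comment> \<open>The inclusion \<open>z \<mapsto> p(k := z)\<close> in coordinates.\<close>
  define \<rho> where "\<rho> = (\<lambda>x. \<lambda>(l, i)\<in>?S. if l = k then x i else \<phi> l (p l) i)"
  have ext: "p \<in> extensional K"
    using p by (simp add: product_manifold_simps PiE_iff)
  have incl: "p(k := z) \<in> PiE K U" "\<kappa> (p(k := z)) = \<rho> (\<phi>0 z)" if "z \<in> U0" for z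
    using that U' ext k by (auto simp: U_def \<phi>_def PiE_iff extensional_def \<kappa>_def \<rho>_def fun_eq_iff)
  note inj = product_chart(1)[OF fin K at, folded \<kappa>_def]
  have smooth: "cont_diff_on d ?S (\<kappa> ` PiE K U) (\<lambda>x. f (inv_into (PiE K U) \<kappa> x))"
    using bspec[OF f[unfolded smooth_fun_def] product_chart_in_atlas[OF at]]
    by (simp add: smooth_on_def \<kappa>_def product_manifold_simps(2))
  have dom: "\<phi>0 ` U0 \<subseteq> (\<Pi>\<^sub>E i\<in>mindex (M k). UNIV)"
    using openin_subset[OF chart_in(3)[OF K[OF k] chart0]] by simp
  have cont: "continuous_map (subtopology (powertop_real (mindex (M k))) (\<phi>0 ` U0))
      (subtopology (powertop_real ?S) (\<kappa> ` PiE K U)) \<rho>"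
    unfolding continuous_map_in_subtopology
  proof
    show "continuous_map (subtopology (powertop_real (mindex (M k))) (\<phi>0 ` U0)) (powertop_real ?S) \<rho>"
      by (auto simp: continuous_map_componentwise \<rho>_def
          intro!: continuous_map_from_subtopology continuous_map_product_projection)
    show "\<rho> \<in> topspace (subtopology (powertop_real (mindex (M k))) (\<phi>0 ` U0)) \<rightarrow> \<kappa> ` PiE K U"
      using incl by (auto simp flip: incl(2))
  qed
  have coord: "(\<exists>j\<in>?S. \<forall>x t. \<rho> (x(i := t)) = (\<rho> x)(j := t) \<and> \<rho> x j = x i) \<or>
      (\<forall>x t. \<rho> (x(i := t)) = \<rho> x)" if "i \<in> mindex (M k)" for i
    using that k by (intro disjI1 bexI[of _ "(k, i)"]) (auto simp: \<rho>_def fun_eq_iff)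
  note pullback = cont_diff_on_coordinate_pullback[OF cont coord dom smooth]
  have "inv_into (PiE K U) \<kappa> (\<rho> x) = p(k := inv_into U0 \<phi>0 x)" if "x \<in> \<phi>0 ` U0" for x
    using incl[OF inv_into_into[OF that]] inv_into_f_f[OF inj] f_inv_into_f[OF that] by metis
  then show "cont_diff_on d (mindex (M k)) (\<phi>0 ` U0) (\<lambda>x. f (p(k := inv_into U0 \<phi>0 x)))"
    by (intro cont_diff_on_cong[OF chart_in(3)[OF K[OF k] chart0] pullback] arg_cong[where f = f])
qed

text \<open>In product charts with the same factors this projection drops the blocks outside
  \<open>J\<close>: a kept coordinate goes to itself, a dropped one leaves the image fixed. It
  serves to pull the Lagrangian of one face back to the section manifold.\<close>

lemma smooth_fun_restrict:
  assumes fin: "finite K" and K: "\<And>k. k \<in> K \<Longrightarrow> charted (M k)" and "J \<subseteq> K"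
    and f: "smooth_fun (product_manifold J M) f"
  shows "smooth_fun (product_manifold K M) (\<lambda>p. f (restrict p J))"
  unfolding smooth_fun_def smooth_on_def product_manifold_simps
proof clarify
  fix U \<phi> d assume at: "\<forall>k\<in>K. (U k, \<phi> k) \<in> matlas (M k)"
  let ?S = "\<lambda>K. SIGMA l:K. mindex (M l)"
  define \<kappa> where "\<kappa> = (\<lambda>K q. \<lambda>(l, i)\<in>?S K. \<phi> l (q l) i)"
  have J: "finite J" "\<And>k. k \<in> J \<Longrightarrow> charted (M k)" "\<forall>k\<in>J. (U k, \<phi> k) \<in> matlas (M k)"
    using assms at finite_subset by blast+
  have chart_K: "inj_on (\<kappa> K) (PiE K U)" "openin (powertop_real (?S K)) (\<kappa> K ` PiE K U)"
    using product_chart[OF fin K at] by (simp_all add: \<kappa>_def)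
  have chart_J: "inj_on (\<kappa> J) (PiE J U)" "openin (powertop_real (?S J)) (\<kappa> J ` PiE J U)"
    using product_chart[OF J] by (simp_all add: \<kappa>_def)
  have res: "restrict q J \<in> PiE J U" "\<kappa> J (restrict q J) = restrict (\<kappa> K q) (?S J)" if "q \<in> PiE K U" for q
    using that \<open>J \<subseteq> K\<close> by (auto simp: \<kappa>_def fun_eq_iff)
  have smooth: "cont_diff_on d (?S J) (\<kappa> J ` PiE J U) (\<lambda>x. f (inv_into (PiE J U) (\<kappa> J) x))"
    using bspec[OF f[unfolded smooth_fun_def] product_chart_in_atlas[OF J(3)]]
    by (simp add: smooth_on_def \<kappa>_def product_manifold_simps(2))
  have dom: "\<kappa> K ` PiE K U \<subseteq> (\<Pi>\<^sub>E i\<in>?S K. UNIV)"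
    using openin_subset[OF chart_K(2)] by simp
  have cont: "continuous_map (subtopology (powertop_real (?S K)) (\<kappa> K ` PiE K U))
      (subtopology (powertop_real (?S J)) (\<kappa> J ` PiE J U)) (\<lambda>x. restrict x (?S J))"
    unfolding continuous_map_in_subtopology
  proof
    show "continuous_map (subtopology (powertop_real (?S K)) (\<kappa> K ` PiE K U)) (powertop_real (?S J))
        (\<lambda>x. restrict x (?S J))"
      using \<open>J \<subseteq> K\<close> by (auto simp: continuous_map_componentwise
          intro!: continuous_map_from_subtopology continuous_map_product_projection)
    show "(\<lambda>x. restrict x (?S J)) \<in> topspace (subtopology (powertop_real (?S K)) (\<kappa> K ` PiE K U)) \<rightarrow> \<kappa> J ` PiE J U"
      using res by (auto simp flip: res(2))
  qed
  have coord: "(\<exists>j\<in>?S J. \<forall>x t. restrict (x(i := t)) (?S J) = (restrict x (?S J))(j := t) \<and> restrict x (?S J) j = x i) \<or>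
      (\<forall>x t. restrict (x(i := t)) (?S J) = restrict x (?S J))" if "i \<in> ?S K" for i
  proof (cases "i \<in> ?S J")
    case True
    then show ?thesis by (intro disjI1 bexI[of _ i]) (auto simp: fun_eq_iff)
  next
    case False
    then show ?thesis by (intro disjI2) (auto simp: fun_eq_iff)
  qed
  note pullback = cont_diff_on_coordinate_pullback[OF cont coord dom smooth]
  have "inv_into (PiE J U) (\<kappa> J) (restrict x (?S J)) = restrict (inv_into (PiE K U) (\<kappa> K) x) J"
    if "x \<in> \<kappa> K ` PiE K U" for x
    using res[OF inv_into_into[OF that]] inv_into_f_f[OF chart_J(1)] f_inv_into_f[OF that] by metis
  then have "cont_diff_on d (?S K) (\<kappa> K ` PiE K U) (\<lambda>x. f (restrict (inv_into (PiE K U) (\<kappa> K) x) J))"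
    by (intro cont_diff_on_cong[OF chart_K(2) pullback] arg_cong[where f = f])
  then show "cont_diff_on d (?S K) ((\<lambda>p. \<lambda>(l, i)\<in>?S K. \<phi> l (p l) i) ` PiE K U)
      (\<lambda>x. f (restrict (inv_into (PiE K U) (\<lambda>p. \<lambda>(l, i)\<in>?S K. \<phi> l (p l) i) x) J))"
    by (simp add: \<kappa>_def)
qed

section \<open>Derivations\<close>

lemma tangent_linear:
  assumes "X \<in> tangent_space M p" "smooth_fun M f" "smooth_fun M g"
  shows "X (\<lambda>q. a * f q + b * g q) = a * X f + b * X g"
  using assms by (simp add: tangent_space_def)

lemma tangent_const:
  assumes "X \<in> tangent_space M p"
  shows "X (\<lambda>q. c) = 0"
proof -
  note s = smooth_fun_const[of M]
  have "X (\<lambda>q. 1 * 1) = 1 * X (\<lambda>q. 1) + 1 * X (\<lambda>q. 1)"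
    using assms s[of 1] by (simp only: tangent_space_def mem_Collect_eq)
  then have "X (\<lambda>q. 1) = 0" by simp
  with tangent_linear[OF assms s[of 1] s[of 0], of c 0] show ?thesis by simp
qed

lemma tangent_sum:
  assumes "X \<in> tangent_space M p" "charted M" "\<And>a. a \<in> A \<Longrightarrow> smooth_fun M (f a)"
  shows "X (\<lambda>q. \<Sum>a\<in>A. f a q) = (\<Sum>a\<in>A. X (f a))"
  using assms(3)
proof (induction A rule: infinite_finite_induct)
  case (insert a A)
  then show ?case
    using tangent_linear[OF assms(1), of "f a" "\<lambda>q. \<Sum>a\<in>A. f a q" 1 1] smooth_fun_sum[OF assms(2), of A f]
    by simp
qed (use tangent_const[OF assms(1)] in auto)

text \<open>The difference of the two functions equals its product with the indicator of the complement
  of \<open>points M\<close>, and both factors vanish at \<open>p\<close>.\<close>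

lemma tangent_cong:
  assumes "X \<in> tangent_space M p" "charted M" "p \<in> points M" "\<And>q. q \<in> points M \<Longrightarrow> f q = g q"
  shows "X f = X g"
proof (cases "smooth_fun M f")
  case True
  then have g: "smooth_fun M g"
    using smooth_fun_cong[OF assms(2,4)] by simp
  define h where "h = (\<lambda>q. f q - g q)"
  define \<kappa> where "\<kappa> = (\<lambda>q. if q \<in> points M then 0 else (1::real))"
  have "smooth_fun M h" "smooth_fun M \<kappa>"
    using smooth_fun_cong[OF assms(2), of "\<lambda>q. 0"] assms(4) smooth_fun_const[of M 0]
    by (auto simp: h_def \<kappa>_def)
  then have "X (\<lambda>q. h q * \<kappa> q) = h p * X \<kappa> + \<kappa> p * X h"
    using assms(1) by (simp add: tangent_space_def)
  moreover have "(\<lambda>q. h q * \<kappa> q) = h"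
    using assms(4) by (auto simp: h_def \<kappa>_def)
  ultimately have "X h = 0"
    using assms(3,4) by (simp add: h_def \<kappa>_def)
  then show ?thesis
    using tangent_linear[OF assms(1) True g, of 1 "-1"] by (simp add: h_def)
next
  case False
  then show ?thesis
    using smooth_fun_cong[OF assms(2,4)] assms(1) by (simp add: tangent_space_def)
qed

section \<open>Linear combinations of tangent tuples and of their jets\<close>

text \<open>Cut down to \<open>K\<close> so that combinations of tangent tuples are extensional and
  hence tangent tuples again.\<close>

definition tuple_comb :: "'k set \<Rightarrow> real \<Rightarrow> ('k \<Rightarrow> 'a tangent) \<Rightarrow> real \<Rightarrow> ('k \<Rightarrow> 'a tangent) \<Rightarrow> 'k \<Rightarrow> 'a tangent" where
  "tuple_comb K a X b Z = (\<lambda>k\<in>K. \<lambda>f. a * X k f + b * Z k f)"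

lemma zero_in_tangent_space: "zero_tangent \<in> tangent_space M p"
  by (simp add: tangent_space_def)

lemma tangent_space_comb:
  assumes "X \<in> tangent_space M p" "Z \<in> tangent_space M p"
  shows "(\<lambda>f. a * X f + b * Z f) \<in> tangent_space M p"
  using assms by (simp add: tangent_space_def algebra_simps)

lemma differential_comb:
  "differential N F (\<lambda>f. a * X f + b * Z f) = (\<lambda>f. a * differential N F X f + b * differential N F Z f)"
  by (auto simp: differential_def)

lemma product_tangent_comb:
  "product_tangent K M p (tuple_comb K a X b Z) =
    (\<lambda>f. a * product_tangent K M p X f + b * product_tangent K M p Z f)"
  by (simp add: product_tangent_def tuple_comb_def differential_comb sum.distrib sum_distrib_left
      cong: sum.cong)

lemma product_tangent_zero: "product_tangent K M p (\<lambda>k\<in>K. zero_tangent) = zero_tangent"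
  by (simp add: product_tangent_def differential_def fun_eq_iff)

lemma product_tangent_apply:
  "smooth_fun (product_manifold K M) f \<Longrightarrow>
    product_tangent K M p X f = (\<Sum>k\<in>K. X k (\<lambda>z. f (p(k := z))))"
  by (simp add: product_tangent_def differential_def)

lemma update_in_product_points:
  assumes "p \<in> points (product_manifold K M)" "k \<in> K" "z \<in> points (M k)"
  shows "p(k := z) \<in> points (product_manifold K M)"
  using assms by (auto simp: product_manifold_simps PiE_iff extensional_def)

text \<open>Each \<open>X k\<close> looks at \<open>f\<close> along the points
  \<open>p(k := z)\<close> only, and these lie in the product when \<open>z\<close> lies in
  \<open>M k\<close>; so \<open>tangent_cong\<close> applies factor by factor. The smoothness test
  inside \<open>differential\<close> has the same outcome for \<open>f\<close> and \<open>g\<close>,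
  which also settles the functions that are not smooth.\<close>

lemma product_tangent_cong:
  assumes "finite K" "\<And>k. k \<in> K \<Longrightarrow> charted (M k)"
    and "p \<in> points (product_manifold K M)" "X \<in> tangent_tuples K M p"
    and eq: "\<And>q. q \<in> points (product_manifold K M) \<Longrightarrow> f q = g q"
  shows "product_tangent K M p X f = product_tangent K M p X g"
proof -
  have "X k (\<lambda>z. f (p(k := z))) = X k (\<lambda>z. g (p(k := z)))" if "k \<in> K" for k
  proof (rule tangent_cong[of "X k" "M k" "p k"])
    show "X k \<in> tangent_space (M k) (p k)"
      using assms(4) that by (auto simp: tangent_tuples_def)
    show "p k \<in> points (M k)"
      using assms(3) that by (auto simp: product_manifold_simps)
  qed (use that assms(2) eq update_in_product_points[OF assms(3) that] in auto)
  moreover have "smooth_fun (product_manifold K M) f \<longleftrightarrow> smooth_fun (product_manifold K M) g"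
    using charted_product_manifold[OF assms(1,2)] eq by (rule smooth_fun_cong)
  ultimately show ?thesis
    unfolding product_tangent_def differential_def by (intro sum.cong refl if_cong)
qed

lemma dL_comb:
  "dL C Y \<L> \<alpha> u (tuple_comb (face_vertices C \<alpha>) a X b Z) = a * dL C Y \<L> \<alpha> u X + b * dL C Y \<L> \<alpha> u Z"
  by (simp add: dL_def differential_real_def product_tangent_comb)

lemma dL_zero: "dL C Y \<L> \<alpha> u (\<lambda>v\<in>face_vertices C \<alpha>. zero_tangent) = 0"
  by (simp add: dL_def differential_real_def product_tangent_zero)

lemma \<theta>d\<Phi>_comb:
  "\<theta>d\<Phi> C Y G \<Phi> \<alpha> u (tuple_comb (face_vertices C \<alpha>) a X b Z) =
    (\<lambda>f. a * \<theta>d\<Phi> C Y G \<Phi> \<alpha> u X f + b * \<theta>d\<Phi> C Y G \<Phi> \<alpha> u Z f)"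
  by (simp add: \<theta>d\<Phi>_def d\<Phi>_def maurer_cartan_def product_tangent_comb differential_comb)

lemma \<theta>d\<Phi>_zero: "\<theta>d\<Phi> C Y G \<Phi> \<alpha> u (\<lambda>v\<in>face_vertices C \<alpha>. zero_tangent) = zero_tangent"
  by (simp add: \<theta>d\<Phi>_def d\<Phi>_def maurer_cartan_def product_tangent_zero differential_def fun_eq_iff)

lemma dual_space_comb:
  "\<xi> \<in> dual_space W \<Longrightarrow> X \<in> W \<Longrightarrow> Z \<in> W \<Longrightarrow> \<xi> (\<lambda>f. a * X f + b * Z f) = a * \<xi> X + b * \<xi> Z"
  by (simp add: dual_space_def)

lemma dual_space_zero:
  assumes "\<xi> \<in> dual_space W" "zero_tangent \<in> W"
  shows "\<xi> zero_tangent = 0"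
  using dual_space_comb[OF assms(1) assms(2) assms(2), of 0 0] by simp

lemma zero_in_lie_algebra: "zero_tangent \<in> lie_algebra G"
  by (simp add: lie_algebra_def zero_in_tangent_space)

lemma j1_comb:
  "face_vertices C \<alpha> \<subseteq> K \<Longrightarrow>
    j1 C (tuple_comb K a X b Z) \<alpha> = tuple_comb (face_vertices C \<alpha>) a (j1 C X \<alpha>) b (j1 C Z \<alpha>)"
  by (auto simp: j1_def tuple_comb_def fun_eq_iff)

lemma jet_proj_j2:
  "\<alpha> \<in> star C v \<Longrightarrow> jet_proj C \<alpha> (j2 C y v) = j1 C y \<alpha>"
  by (auto simp: jet_proj_def j2_def j1_def star_vertices_def fun_eq_iff)

section \<open>The multiplier of a regular admissible section\<close>

locale regular_admissible_section =
  fixes C :: "'c cell_complex"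
    and \<V> :: "'c set"
    and Y :: "'c \<Rightarrow> ('y, 'i) manifold"
    and \<L> :: "'c \<Rightarrow> ('c \<Rightarrow> 'y) \<Rightarrow> real"
    and G :: "('g, 'j) lie_group"
    and \<Phi> :: "'c \<Rightarrow> ('c \<Rightarrow> 'y) \<Rightarrow> 'g"
    and y :: "'c \<Rightarrow> 'y"
  assumes finite_face_vertices: "\<And>\<alpha>. \<alpha> \<in> faces C \<Longrightarrow> finite (face_vertices C \<alpha>)"
    and finite_domain: "finite \<V>" and domain_faces: "\<V> \<subseteq> faces C"
    and manifolds: "\<And>v. v \<in> vertices C \<Longrightarrow> smooth_manifold (Y v)"
    and smooth_lagrangian: "\<And>\<alpha>. \<alpha> \<in> faces C \<Longrightarrow> smooth_fun (J1 C Y \<alpha>) (\<L> \<alpha>)"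
    and lie_group: "lie_group G"
    and smooth_constraint: "\<And>\<alpha>. \<alpha> \<in> faces C \<Longrightarrow> smooth_map (J1 C Y \<alpha>) (mfd G) (\<Phi> \<alpha>)"
    and admissible: "admissible_section C Y G \<Phi> \<V> y"
    and regular: "regular_section C Y G \<Phi> \<V> y"
begin

abbreviation "D \<equiv> domain_vertices C \<V>"

abbreviation "T \<equiv> boundary_fixing_tangents C Y \<V> y"

definition lagrangian_form :: "('c \<Rightarrow> 'y tangent) \<Rightarrow> real" where
  "lagrangian_form \<delta>y = (\<Sum>\<alpha>\<in>\<V>. dL C Y \<L> \<alpha> (j1 C y \<alpha>) (j1 C \<delta>y \<alpha>))"

definition constraint_form :: "'c \<Rightarrow> ('c \<Rightarrow> 'y tangent) \<Rightarrow> 'g tangent" where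
  "constraint_form \<alpha> \<delta>y = \<theta>d\<Phi> C Y G \<Phi> \<alpha> (j1 C y \<alpha>) (j1 C \<delta>y \<alpha>)"

text \<open>The action form at \<open>(y, lam)\<close> as a functional of \<open>\<delta>y\<close>
  alone, split so that the unknown \<open>lam\<close> enters through the second summand
  only.\<close>

definition extended_form :: "('c \<Rightarrow> 'g tangent \<Rightarrow> real) \<Rightarrow> ('c \<Rightarrow> 'y tangent) \<Rightarrow> real" where
  "extended_form lam \<delta>y = lagrangian_form \<delta>y + (\<Sum>\<alpha>\<in>\<V>. lam \<alpha> (constraint_form \<alpha> \<delta>y))"

definition euler_lagrange_equations :: "('c \<Rightarrow> 'g tangent \<Rightarrow> real) \<Rightarrow> bool" where
  "euler_lagrange_equations lam \<longleftrightarrow>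
     (\<forall>v\<in>interior_vertices C \<V>. \<forall>X\<in>tangent_tuples (star_vertices C v) Y (j2 C y v).
        euler_lagrange C Y \<L> v (j2 C y v) X + multiplier_form C Y G \<Phi> lam v (j2 C y v) X = 0)"

section \<open>Linear structure of the boundary-fixing tangent tuples\<close>

lemma face_vertices_domain: "\<alpha> \<in> \<V> \<Longrightarrow> face_vertices C \<alpha> \<subseteq> D"
  by (auto simp: domain_vertices_def)

lemma domain_vertices_subset: "D \<subseteq> vertices C"
  by (auto simp: domain_vertices_def face_vertices_def)

lemma finite_domain_vertices: "finite D"
  using finite_domain domain_faces finite_face_vertices by (auto simp: domain_vertices_def)

lemma charted_fibre: "v \<in> D \<Longrightarrow> charted (Y v)"
  using domain_vertices_subset manifolds smooth_manifold_charted by blast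

lemma in_star_iff: "v \<in> D \<Longrightarrow> \<alpha> \<in> \<V> \<Longrightarrow> \<alpha> \<in> star C v \<longleftrightarrow> v \<in> face_vertices C \<alpha>"
  using domain_vertices_subset domain_faces by (auto simp: star_def face_vertices_def)

lemma in_star_vertices: "v \<in> D \<Longrightarrow> v \<in> star_vertices C v"
  using domain_faces
  by (auto simp: domain_vertices_def star_vertices_def star_def face_vertices_def)

lemma section_in_points: "y \<in> points (product_manifold D Y)"
  using admissible by (simp add: admissible_section_def sections_def)

lemma j1_in_points: "\<alpha> \<in> \<V> \<Longrightarrow> j1 C y \<alpha> \<in> points (product_manifold (face_vertices C \<alpha>) Y)"
  using admissible by (simp add: admissible_section_def constraint_set_def J1_def)

lemma constraint_at_jet: "\<alpha> \<in> \<V> \<Longrightarrow> \<Phi> \<alpha> (j1 C y \<alpha>) = \<one>\<^bsub>G\<^esub>"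
  using admissible by (simp add: admissible_section_def constraint_set_def)

lemma T_component: "\<delta>y \<in> T \<Longrightarrow> v \<in> D \<Longrightarrow> \<delta>y v \<in> tangent_space (Y v) (y v)"
  by (auto simp: boundary_fixing_tangents_def section_tangents_def tangent_tuples_def)

lemma T_extensional: "\<delta>y \<in> T \<Longrightarrow> \<delta>y \<in> extensional D"
  by (simp add: boundary_fixing_tangents_def section_tangents_def tangent_tuples_def PiE_iff)

lemma T_frontier: "\<delta>y \<in> T \<Longrightarrow> v \<in> frontier_vertices C \<V> \<Longrightarrow> \<delta>y v = zero_tangent"
  by (auto simp: boundary_fixing_tangents_def)

lemma T_comb:
  assumes "X \<in> T" "Z \<in> T"
  shows "tuple_comb D a X b Z \<in> T"
proof -
  have "frontier_vertices C \<V> \<subseteq> D"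
    by (auto simp: frontier_vertices_def)
  then show ?thesis
    using assms
    by (auto simp: boundary_fixing_tangents_def section_tangents_def tangent_tuples_def tuple_comb_def
        PiE_iff intro!: tangent_space_comb)
qed

lemma single_vertex_in_T:
  assumes "v \<in> interior_vertices C \<V>" "X v \<in> tangent_space (Y v) (y v)"
  shows "tuple_component D v X \<in> T"
  using assms zero_in_tangent_space
  by (auto simp: boundary_fixing_tangents_def section_tangents_def tangent_tuples_def
      tuple_component_def frontier_vertices_def)

lemma lagrangian_form_comb:
  "lagrangian_form (tuple_comb D a X b Z) = a * lagrangian_form X + b * lagrangian_form Z"
  by (simp add: lagrangian_form_def j1_comb face_vertices_domain dL_comb sum.distrib sum_distrib_left)

lemma constraint_form_comb:
  "\<alpha> \<in> \<V> \<Longrightarrow> constraint_form \<alpha> (tuple_comb D a X b Z) =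
    (\<lambda>f. a * constraint_form \<alpha> X f + b * constraint_form \<alpha> Z f)"
  by (simp add: constraint_form_def j1_comb face_vertices_domain \<theta>d\<Phi>_comb)

text \<open>\<open>regular_section\<close> is an equality of sets. This is the inclusion of the
  image in the Lie algebra valued maps; \<open>constraint_form_onto\<close> is the converse
  inclusion.\<close>

lemma constraint_form_in_lie_algebra:
  assumes "\<delta>y \<in> T" "\<alpha> \<in> \<V>"
  shows "constraint_form \<alpha> \<delta>y \<in> lie_algebra G"
proof -
  have "(\<lambda>\<alpha>\<in>\<V>. constraint_form \<alpha> \<delta>y) \<in> (\<V> \<rightarrow>\<^sub>E lie_algebra G)"
    using regular assms(1) unfolding regular_section_def constraint_form_def by blast
  from PiE_mem[OF this assms(2)] show ?thesis using assms(2) by simp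
qed

lemma constraint_form_onto:
  assumes "\<xi> \<in> \<V> \<rightarrow>\<^sub>E lie_algebra G"
  obtains \<delta>y where "\<delta>y \<in> T" "\<And>\<alpha>. \<alpha> \<in> \<V> \<Longrightarrow> constraint_form \<alpha> \<delta>y = \<xi> \<alpha>"
proof -
  obtain \<delta>y where "\<delta>y \<in> T" "\<xi> = (\<lambda>\<alpha>\<in>\<V>. constraint_form \<alpha> \<delta>y)"
    using regular assms unfolding regular_section_def constraint_form_def by blast
  then show ?thesis using that[of \<delta>y] by simp
qed

lemma multiplier_dual: "lam \<in> multipliers G \<V> \<Longrightarrow> \<alpha> \<in> \<V> \<Longrightarrow> lam \<alpha> \<in> dual_space (lie_algebra G)"
  by (auto simp: multipliers_def)

lemma extended_form_comb:
  assumes lam: "lam \<in> multipliers G \<V>" and "X \<in> T" "Z \<in> T"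
  shows "extended_form lam (tuple_comb D a X b Z) = a * extended_form lam X + b * extended_form lam Z"
proof -
  have "lam \<alpha> (constraint_form \<alpha> (tuple_comb D a X b Z))
      = a * lam \<alpha> (constraint_form \<alpha> X) + b * lam \<alpha> (constraint_form \<alpha> Z)" if "\<alpha> \<in> \<V>" for \<alpha>
    using constraint_form_comb[OF that] dual_space_comb[OF multiplier_dual[OF lam that]]
      constraint_form_in_lie_algebra that assms by simp
  then show ?thesis
    by (simp add: extended_form_def lagrangian_form_comb sum.distrib sum_distrib_left algebra_simps)
qed

lemma extended_form_zero:
  assumes lam: "lam \<in> multipliers G \<V>"
  shows "extended_form lam (\<lambda>v\<in>D. zero_tangent) = 0"
proof -
  have "j1 C (\<lambda>v\<in>D. zero_tangent :: 'y tangent) \<alpha> = (\<lambda>v\<in>face_vertices C \<alpha>. zero_tangent)" if "\<alpha> \<in> \<V>" for \<alpha>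
    using face_vertices_domain[OF that] by (auto simp: j1_def fun_eq_iff)
  then show ?thesis
    by (simp add: extended_form_def lagrangian_form_def constraint_form_def dL_zero \<theta>d\<Phi>_zero
        dual_space_zero[OF multiplier_dual[OF lam] zero_in_lie_algebra])
qed

lemma action_form_eq:
  "action_form C Y \<L> G \<Phi> \<V> (y, lam) (\<delta>y, \<delta>lam) = extended_form lam \<delta>y"
  by (simp add: action_form_def extended_form_def lagrangian_form_def constraint_form_def sum.distrib)

section \<open>Localisation at a vertex and the Euler-Lagrange equations\<close>

text \<open>The jet of a tuple supported at \<open>v\<close> is zero on every face outside the star
  of \<open>v\<close>, and on a face of the star it is the argument of the Cartan forms. Since the
  star of an interior vertex lies in \<V>, the sum over \<V> shrinks to the sum over the complete
  star.\<close>

lemma extended_form_single_vertex: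
  assumes lam: "lam \<in> multipliers G \<V>" and v: "v \<in> interior_vertices C \<V>"
  shows "extended_form lam (tuple_component D v X) =
    euler_lagrange C Y \<L> v (j2 C y v) X + multiplier_form C Y G \<Phi> lam v (j2 C y v) X"
proof -
  have vD: "v \<in> D" and star: "star C v \<subseteq> \<V>"
    using v by (auto simp: interior_vertices_def)
  have jet: "j1 C (tuple_component D v X) \<alpha> =
      (if \<alpha> \<in> star C v then tuple_component (face_vertices C \<alpha>) v (jet_proj C \<alpha> X)
       else (\<lambda>v\<in>face_vertices C \<alpha>. zero_tangent))" if "\<alpha> \<in> \<V>" for \<alpha>
    using face_vertices_domain[OF that] in_star_iff[OF vD that]
    by (auto simp: j1_def tuple_component_def jet_proj_def fun_eq_iff)
  have "lagrangian_form (tuple_component D v X) = euler_lagrange C Y \<L> v (j2 C y v) X"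
    unfolding lagrangian_form_def euler_lagrange_def \<Theta>L_def
    using finite_domain star
    by (intro sum.mono_neutral_cong_right) (auto simp: jet dL_zero jet_proj_j2)
  moreover have "(\<Sum>\<alpha>\<in>\<V>. lam \<alpha> (constraint_form \<alpha> (tuple_component D v X)))
      = multiplier_form C Y G \<Phi> lam v (j2 C y v) X"
    unfolding constraint_form_def multiplier_form_def \<Theta>\<Phi>_def
    using finite_domain star
    by (intro sum.mono_neutral_cong_right)
      (auto simp: jet \<theta>d\<Phi>_zero jet_proj_j2 dual_space_zero[OF multiplier_dual[OF lam] zero_in_lie_algebra])
  ultimately show ?thesis
    by (simp add: extended_form_def)
qed

text \<open>The tuples supported at one interior vertex span \<open>T\<close>: the components of a
  boundary-fixing tuple at frontier vertices are zero, and there are finitely many vertices.\<close>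

lemma extended_form_vanishes_iff:
  assumes lam: "lam \<in> multipliers G \<V>"
  shows "(\<forall>\<delta>y\<in>T. extended_form lam \<delta>y = 0) \<longleftrightarrow> euler_lagrange_equations lam"
proof
  assume crit: "\<forall>\<delta>y\<in>T. extended_form lam \<delta>y = 0"
  show "euler_lagrange_equations lam"
    unfolding euler_lagrange_equations_def
  proof (intro ballI)
    fix v X assume v: "v \<in> interior_vertices C \<V>" and X: "X \<in> tangent_tuples (star_vertices C v) Y (j2 C y v)"
    have "X v \<in> tangent_space (Y v) (y v)"
      using PiE_mem[OF X[unfolded tangent_tuples_def]] in_star_vertices[of v] v
      by (simp add: j2_def interior_vertices_def)
    then show "euler_lagrange C Y \<L> v (j2 C y v) X + multiplier_form C Y G \<Phi> lam v (j2 C y v) X = 0"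
      using crit single_vertex_in_T[OF v] extended_form_single_vertex[OF lam v, of X] by simp
  qed
next
  assume el: "euler_lagrange_equations lam"
  show "\<forall>\<delta>y\<in>T. extended_form lam \<delta>y = 0"
  proof
    fix \<delta>y assume \<delta>y: "\<delta>y \<in> T"
    \<comment> \<open>Truncation of \<open>\<delta>y\<close> to \<open>A\<close>. Adding one vertex
      at a time leads from the zero tuple to \<open>mask D = \<delta>y\<close>.\<close>
    define mask where "mask A = (\<lambda>v\<in>D. if v \<in> A then \<delta>y v else zero_tangent)" for A
    have single: "extended_form lam (tuple_component D v \<delta>y) = 0 \<and> tuple_component D v \<delta>y \<in> T"
      if v: "v \<in> D" for v
    proof (cases "v \<in> interior_vertices C \<V>")
      case True
      have "star_vertices C v \<subseteq> D"
        using True by (auto simp: interior_vertices_def star_vertices_def domain_vertices_def)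
      then have X: "j2 C \<delta>y v \<in> tangent_tuples (star_vertices C v) Y (j2 C y v)"
        using T_component[OF \<delta>y] by (auto simp: tangent_tuples_def j2_def)
      \<comment> \<open>Only the value at \<open>v\<close> matters, so \<open>\<delta>y\<close> may
        be exchanged for its second jet, over which the Euler-Lagrange equations quantify.\<close>
      have "tuple_component D v \<delta>y = tuple_component D v (j2 C \<delta>y v)"
        using in_star_vertices[OF v]
        by (auto simp: tuple_component_def j2_def)
      then show ?thesis
        using extended_form_single_vertex[OF lam True] el X True
          single_vertex_in_T[OF True, of \<delta>y] T_component[OF \<delta>y v]
        by (simp add: euler_lagrange_equations_def)
    next
      case False
      then have "\<delta>y v = zero_tangent"
        using T_frontier[OF \<delta>y] v by (auto simp: frontier_vertices_def)
      then have "tuple_component D v \<delta>y = (\<lambda>v\<in>D. zero_tangent)"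
        by (auto simp: tuple_component_def)
      moreover have "(\<lambda>v\<in>D. zero_tangent) \<in> T"
        using T_comb[OF \<delta>y \<delta>y, of 0 0] by (simp add: tuple_comb_def)
      ultimately show ?thesis
        using extended_form_zero[OF lam] by simp
    qed
    have "extended_form lam (mask A) = 0 \<and> mask A \<in> T" if "finite A" "A \<subseteq> D" for A
      using that
    proof (induction A)
      case empty
      have "mask {} = (\<lambda>v\<in>D. zero_tangent)" by (simp add: mask_def cong: restrict_cong)
      moreover have "(\<lambda>v\<in>D. zero_tangent) \<in> T"
        using T_comb[OF \<delta>y \<delta>y, of 0 0] by (simp add: tuple_comb_def)
      ultimately show ?case
        using extended_form_zero[OF lam] by metis
    next
      case (insert v A)
      have "mask (insert v A) = tuple_comb D 1 (mask A) 1 (tuple_component D v \<delta>y)"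
        using insert by (auto simp: mask_def tuple_comb_def tuple_component_def fun_eq_iff)
      then show ?case
        using insert single[of v] extended_form_comb[OF lam] T_comb by simp
    qed
    moreover have "mask D = \<delta>y"
      using T_extensional[OF \<delta>y] by (auto simp: mask_def fun_eq_iff extensional_def)
    ultimately show "extended_form lam \<delta>y = 0"
      using finite_domain_vertices by force
  qed
qed

section \<open>Comparison with the differentials in the Lagrange problem\<close>

text \<open>At the jet of an admissible section \<Phi> takes the value e, so the Maurer-Cartan form
  is the push-forward along translation by the inverse of e. That translation fixes the carrier
  pointwise, and derivations do not see beyond it. Thus the kernel in the definition of admissible
  tangents is the kernel of the map in the definition of regularity.\<close>

lemma constraint_form_eq_differential:
  assumes "\<delta>y \<in> T" "\<alpha> \<in> \<V>"
  shows "constraint_form \<alpha> \<delta>y = d\<Phi> C Y G \<Phi> \<alpha> (j1 C y \<alpha>) (j1 C \<delta>y \<alpha>)"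
proof
  interpret group G using lie_group by (simp add: lie_group_def)
  fix h :: "'g \<Rightarrow> real"
  let ?h = "\<lambda>g. h (inv\<^bsub>G\<^esub> \<one>\<^bsub>G\<^esub> \<otimes>\<^bsub>G\<^esub> g)"
  have pts: "points (mfd G) = carrier G" and "charted (mfd G)"
    using lie_group smooth_manifold_charted by (auto simp: lie_group_def)
  have h: "?h g = h g" if "g \<in> points (mfd G)" for g
    using that pts by simp
  \<comment> \<open>The outer push-forward hands \<open>?h\<close> to the inner one, which tests
    \<open>?h\<close> for smoothness in place of \<open>h\<close>.\<close>
  have smooth: "smooth_fun (mfd G) ?h \<longleftrightarrow> smooth_fun (mfd G) h"
    using \<open>charted (mfd G)\<close> h by (rule smooth_fun_cong)
  have maps: "\<Phi> \<alpha> q \<in> points (mfd G)" if "q \<in> points (product_manifold (face_vertices C \<alpha>) Y)" for q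
    using smooth_constraint[OF subsetD[OF domain_faces assms(2)]] that
    by (auto simp: smooth_map_def J1_def continuous_map_def)
  have "product_tangent (face_vertices C \<alpha>) Y (j1 C y \<alpha>) (j1 C \<delta>y \<alpha>) (\<lambda>q. ?h (\<Phi> \<alpha> q)) =
      product_tangent (face_vertices C \<alpha>) Y (j1 C y \<alpha>) (j1 C \<delta>y \<alpha>) (\<lambda>q. h (\<Phi> \<alpha> q))"
  proof (rule product_tangent_cong)
    show "finite (face_vertices C \<alpha>)"
      using finite_face_vertices domain_faces assms(2) by blast
    show "j1 C \<delta>y \<alpha> \<in> tangent_tuples (face_vertices C \<alpha>) Y (j1 C y \<alpha>)"
      using T_component[OF assms(1)] face_vertices_domain[OF assms(2)]
      by (auto simp: tangent_tuples_def j1_def)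
  qed (use assms(2) charted_fibre face_vertices_domain j1_in_points maps h in auto)
  then show "constraint_form \<alpha> \<delta>y h = d\<Phi> C Y G \<Phi> \<alpha> (j1 C y \<alpha>) (j1 C \<delta>y \<alpha>) h"
    using smooth
    by (auto simp: constraint_form_def \<theta>d\<Phi>_def maurer_cartan_def constraint_at_jet[OF assms(2)]
        d\<Phi>_def differential_def)
qed

text \<open>Both sides are double sums over vertices and faces, one of them restricted to the
  vertices of each face. After exchanging the sums, the additional terms are derivatives of
  constants.\<close>

lemma differential_action:
  assumes \<delta>y: "\<delta>y \<in> T"
  shows "differential_real (action C \<L> \<V>) (product_tangent D Y y \<delta>y) = lagrangian_form \<delta>y"
proof -
  have smooth: "smooth_fun (product_manifold D Y) (\<lambda>p. \<L> \<alpha> (j1 C p \<alpha>))" if "\<alpha> \<in> \<V>" for \<alpha>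
    unfolding j1_def
    using smooth_lagrangian[of \<alpha>] domain_faces that
    by (intro smooth_fun_restrict[OF finite_domain_vertices charted_fibre face_vertices_domain])
      (auto simp: J1_def)
  have charted: "charted (product_manifold D Y)"
    using finite_domain_vertices charted_fibre by (rule charted_product_manifold)
  \<comment> \<open>Smoothness excludes the default value 0 of \<open>differential\<close>.\<close>
  have "smooth_fun (product_manifold D Y) (action C \<L> \<V>)"
    unfolding action_def using charted smooth by (rule smooth_fun_sum)
  then have "differential_real (action C \<L> \<V>) (product_tangent D Y y \<delta>y) =
      (\<Sum>v\<in>D. \<delta>y v (\<lambda>z. \<Sum>\<alpha>\<in>\<V>. \<L> \<alpha> (j1 C (y(v := z)) \<alpha>)))"
    by (simp add: differential_real_def product_tangent_apply action_def)
  also have "\<dots> = (\<Sum>v\<in>D. \<Sum>\<alpha>\<in>\<V>. \<delta>y v (\<lambda>z. \<L> \<alpha> (j1 C (y(v := z)) \<alpha>)))"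
  proof (intro sum.cong refl tangent_sum)
    fix v \<alpha> assume v: "v \<in> D" and "\<alpha> \<in> \<V>"
    then show "smooth_fun (Y v) (\<lambda>z. \<L> \<alpha> (j1 C (y(v := z)) \<alpha>))"
      by (intro smooth_fun_factor_inclusion[OF charted_fibre finite_domain_vertices section_in_points v smooth])
  qed (use T_component[OF \<delta>y] charted_fibre in auto)
  also have "\<dots> = (\<Sum>\<alpha>\<in>\<V>. \<Sum>v\<in>D. \<delta>y v (\<lambda>z. \<L> \<alpha> (j1 C (y(v := z)) \<alpha>)))"
    by (rule sum.swap)
  also have "\<dots> = (\<Sum>\<alpha>\<in>\<V>. dL C Y \<L> \<alpha> (j1 C y \<alpha>) (j1 C \<delta>y \<alpha>))"
  proof (intro sum.cong refl)
    fix \<alpha> assume \<alpha>: "\<alpha> \<in> \<V>"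
    have "(\<Sum>v\<in>D. \<delta>y v (\<lambda>z. \<L> \<alpha> (j1 C (y(v := z)) \<alpha>))) =
        (\<Sum>v\<in>face_vertices C \<alpha>. j1 C \<delta>y \<alpha> v (\<lambda>z. \<L> \<alpha> ((j1 C y \<alpha>)(v := z))))"
    proof (rule sum.mono_neutral_cong_right[OF finite_domain_vertices face_vertices_domain[OF \<alpha>]])
      \<comment> \<open>Varying \<open>y\<close> at a vertex outside the face does not change its
        jet there.\<close>
      show "\<forall>v\<in>D - face_vertices C \<alpha>. \<delta>y v (\<lambda>z. \<L> \<alpha> (j1 C (y(v := z)) \<alpha>)) = 0"
        using tangent_const[OF T_component[OF \<delta>y]] by (simp add: j1_def)
      show "\<delta>y v (\<lambda>z. \<L> \<alpha> (j1 C (y(v := z)) \<alpha>)) = j1 C \<delta>y \<alpha> v (\<lambda>z. \<L> \<alpha> ((j1 C y \<alpha>)(v := z)))"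
        if "v \<in> face_vertices C \<alpha>" for v
      proof -
        have "j1 C (y(v := z)) \<alpha> = (j1 C y \<alpha>)(v := z)" for z
          using that by (auto simp: j1_def)
        then show ?thesis
          using that by (simp add: j1_def)
      qed
    qed
    also have "\<dots> = dL C Y \<L> \<alpha> (j1 C y \<alpha>) (j1 C \<delta>y \<alpha>)"
      using smooth_lagrangian[of \<alpha>] domain_faces \<alpha>
      by (auto simp: dL_def differential_real_def product_tangent_apply J1_def)
    finally show "(\<Sum>v\<in>D. \<delta>y v (\<lambda>z. \<L> \<alpha> (j1 C (y(v := z)) \<alpha>))) = dL C Y \<L> \<alpha> (j1 C y \<alpha>) (j1 C \<delta>y \<alpha>)" .
  qed
  finally show ?thesis by (simp add: lagrangian_form_def)
qed

lemma critical_section_iff: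
  "critical_section C Y \<L> G \<Phi> \<V> y \<longleftrightarrow>
    (\<forall>\<delta>y\<in>T. (\<forall>\<alpha>\<in>\<V>. constraint_form \<alpha> \<delta>y = zero_tangent) \<longrightarrow> lagrangian_form \<delta>y = 0)"
proof -
  have *: "\<delta>y \<in> admissible_tangents C Y G \<Phi> \<V> y \<and> (\<forall>v\<in>frontier_vertices C \<V>. \<delta>y v = zero_tangent) \<longleftrightarrow>
      \<delta>y \<in> T \<and> (\<forall>\<alpha>\<in>\<V>. constraint_form \<alpha> \<delta>y = zero_tangent)" for \<delta>y
  proof (cases "\<delta>y \<in> T")
    case True
    then show ?thesis
      using constraint_form_eq_differential[OF True]
      by (auto simp: admissible_tangents_def boundary_fixing_tangents_def)
  next
    case False
    then show ?thesis
      by (auto simp: admissible_tangents_def boundary_fixing_tangents_def)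
  qed
  have "critical_section C Y \<L> G \<Phi> \<V> y \<longleftrightarrow>
      (\<forall>\<delta>y. \<delta>y \<in> admissible_tangents C Y G \<Phi> \<V> y \<and> (\<forall>v\<in>frontier_vertices C \<V>. \<delta>y v = zero_tangent) \<longrightarrow>
        differential_real (action C \<L> \<V>) (product_tangent D Y y \<delta>y) = 0)"
    using admissible by (auto simp: critical_section_def)
  then show ?thesis
    unfolding * using differential_action by auto
qed

section \<open>Uniqueness and existence of the multiplier\<close>

text \<open>By regularity some \<open>\<delta>y\<close> has constraint value \<eta> at \<alpha> and
  zero at all other faces. On it the vanishing extended form reads
  \<open>lagrangian_form \<delta>y + lam \<alpha> \<eta> = 0\<close>, which determines
  \<open>lam \<alpha> \<eta>\<close>. Off the Lie algebra extensionality decides.\<close>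

lemma multiplier_unique:
  assumes lam: "lam \<in> multipliers G \<V>" "euler_lagrange_equations lam"
    and mu: "\<mu> \<in> multipliers G \<V>" "euler_lagrange_equations \<mu>"
  shows "lam = \<mu>"
proof -
  have zero: "\<nu> \<alpha> zero_tangent = 0" if "\<nu> \<in> multipliers G \<V>" "\<alpha> \<in> \<V>" for \<nu> \<alpha>
    using dual_space_zero[OF multiplier_dual[OF that] zero_in_lie_algebra] .
  have "lam \<alpha> \<eta> = \<mu> \<alpha> \<eta>" if \<alpha>: "\<alpha> \<in> \<V>" and \<eta>: "\<eta> \<in> lie_algebra G" for \<alpha> \<eta>
  proof -
    have "(\<lambda>\<beta>\<in>\<V>. if \<beta> = \<alpha> then \<eta> else zero_tangent) \<in> \<V> \<rightarrow>\<^sub>E lie_algebra G"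
      using \<eta> zero_in_lie_algebra by auto
    then obtain \<delta>y where \<delta>y: "\<delta>y \<in> T"
      "\<And>\<beta>. \<beta> \<in> \<V> \<Longrightarrow> constraint_form \<beta> \<delta>y = (\<lambda>\<beta>\<in>\<V>. if \<beta> = \<alpha> then \<eta> else zero_tangent) \<beta>"
      by (rule constraint_form_onto) blast
    have "(\<Sum>\<beta>\<in>\<V>. \<nu> \<beta> (constraint_form \<beta> \<delta>y)) = (\<Sum>\<beta>\<in>\<V>. if \<beta> = \<alpha> then \<nu> \<alpha> \<eta> else 0)"
      if "\<nu> \<in> multipliers G \<V>" for \<nu>
      using \<delta>y(2) zero[OF that] by (intro sum.cong) auto
    then have "extended_form \<nu> \<delta>y = lagrangian_form \<delta>y + \<nu> \<alpha> \<eta>" if "\<nu> \<in> multipliers G \<V>" for \<nu>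
      using that finite_domain \<alpha> by (simp add: extended_form_def)
    moreover have "extended_form lam \<delta>y = 0" "extended_form \<mu> \<delta>y = 0"
      using assms extended_form_vanishes_iff \<delta>y(1) by blast+
    ultimately show ?thesis
      using lam(1) mu(1) by simp
  qed
  moreover have "\<nu> \<alpha> \<in> extensional (lie_algebra G)" if "\<nu> \<in> multipliers G \<V>" "\<alpha> \<in> \<V>" for \<nu> \<alpha>
    using multiplier_dual[OF that] by (simp add: dual_space_def)
  ultimately have "lam \<alpha> = \<mu> \<alpha>" if "\<alpha> \<in> \<V>" for \<alpha>
    using that lam(1) mu(1) by (metis extensionalityI)
  then show ?thesis
    using lam(1) mu(1) unfolding multipliers_def by (rule PiE_ext[rotated 2])
qed

text \<open>The Lagrangian form vanishes on the kernel of the surjective constraint map, hence factors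
  through it; the factor, restricted to the summands of \<open>Map(\<V>, \<gg>)\<close>, is minus the multiplier.\<close>

lemma multiplier_exists:
  assumes crit: "critical_section C Y \<L> G \<Phi> \<V> y"
  obtains lam where "lam \<in> multipliers G \<V>" "euler_lagrange_equations lam"
proof -
  define single where "single \<alpha> \<eta> = (\<lambda>\<beta>\<in>\<V>. if \<beta> = \<alpha> then \<eta> else zero_tangent)" for \<alpha> and \<eta> :: "'g tangent"
  have ex: "\<exists>\<delta>y. \<delta>y \<in> T \<and> (\<forall>\<beta>\<in>\<V>. constraint_form \<beta> \<delta>y = single \<alpha> \<eta> \<beta>)" if "\<eta> \<in> lie_algebra G" for \<alpha> \<eta>
  proof -
    have "single \<alpha> \<eta> \<in> \<V> \<rightarrow>\<^sub>E lie_algebra G"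
      using that zero_in_lie_algebra by (auto simp: single_def)
    then show ?thesis by (rule constraint_form_onto) blast
  qed
  \<comment> \<open>An arbitrary lift of the map with value \<eta> at \<alpha> and zero elsewhere.
    It need not be linear in \<eta>; \<open>factor\<close> makes the Lagrangian form independent of
    the lift, which restores linearity.\<close>
  define s where "s \<alpha> \<eta> = (SOME \<delta>y. \<delta>y \<in> T \<and> (\<forall>\<beta>\<in>\<V>. constraint_form \<beta> \<delta>y = single \<alpha> \<eta> \<beta>))" for \<alpha> \<eta>
  have s: "s \<alpha> \<eta> \<in> T" "\<And>\<beta>. \<beta> \<in> \<V> \<Longrightarrow> constraint_form \<beta> (s \<alpha> \<eta>) = single \<alpha> \<eta> \<beta>"
    if "\<eta> \<in> lie_algebra G" for \<alpha> \<eta>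
    using someI_ex[OF ex[OF that, of \<alpha>]] unfolding s_def by blast+
  have factor: "lagrangian_form X = lagrangian_form Z"
    if "X \<in> T" "Z \<in> T" "\<And>\<alpha>. \<alpha> \<in> \<V> \<Longrightarrow> constraint_form \<alpha> X = constraint_form \<alpha> Z" for X Z
  proof -
    have "lagrangian_form (tuple_comb D 1 X (-1) Z) = 0"
      using crit that T_comb constraint_form_comb unfolding critical_section_iff by simp
    then show ?thesis by (simp add: lagrangian_form_comb)
  qed
  \<comment> \<open>The sign makes the extended form vanish on every lift
    \<open>s \<alpha> \<eta>\<close>.\<close>
  define lam where "lam = (\<lambda>\<alpha>\<in>\<V>. \<lambda>\<eta>\<in>lie_algebra G. - lagrangian_form (s \<alpha> \<eta>))"
  have comb: "(\<lambda>f. a * \<eta> f + b * \<zeta> f) \<in> lie_algebra G"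
    if "\<eta> \<in> lie_algebra G" "\<zeta> \<in> lie_algebra G" for \<eta> \<zeta> a b
    using that by (simp add: lie_algebra_def tangent_space_comb)
  have "lam \<in> multipliers G \<V>"
  proof -
    have "lagrangian_form (s \<alpha> (\<lambda>f. a * \<eta> f + b * \<zeta> f)) = a * lagrangian_form (s \<alpha> \<eta>) + b * lagrangian_form (s \<alpha> \<zeta>)"
      if "\<alpha> \<in> \<V>" and e: "\<eta> \<in> lie_algebra G" "\<zeta> \<in> lie_algebra G" for \<alpha> \<eta> \<zeta> a b
    proof -
      have "lagrangian_form (s \<alpha> (\<lambda>f. a * \<eta> f + b * \<zeta> f)) = lagrangian_form (tuple_comb D a (s \<alpha> \<eta>) b (s \<alpha> \<zeta>))"
        using s e comb[OF e] by (intro factor T_comb) (auto simp: constraint_form_comb single_def)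
      then show ?thesis by (simp add: lagrangian_form_comb)
    qed
    then show ?thesis
      using comb by (auto simp: multipliers_def dual_space_def lam_def algebra_simps)
  qed
  moreover have "extended_form lam \<delta>y = 0" if \<delta>y: "\<delta>y \<in> T" for \<delta>y
  proof -
    have mem: "constraint_form \<alpha> \<delta>y \<in> lie_algebra G" if "\<alpha> \<in> \<V>" for \<alpha>
      using constraint_form_in_lie_algebra[OF \<delta>y that] .
    let ?s = "\<lambda>\<alpha>. s \<alpha> (constraint_form \<alpha> \<delta>y)"
    \<comment> \<open>\<open>X\<close> is the partial sum over \<open>A\<close> of lifts of the
      single values of \<open>\<delta>y\<close>. For \<open>A = \<V>\<close> it has the same
      constraint values as \<open>\<delta>y\<close>, hence by \<open>factor\<close> the same
      Lagrangian form.\<close>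
    have "\<exists>X\<in>T. lagrangian_form X = (\<Sum>\<alpha>\<in>A. lagrangian_form (?s \<alpha>)) \<and>
        (\<forall>\<beta>\<in>\<V>. constraint_form \<beta> X = (if \<beta> \<in> A then constraint_form \<beta> \<delta>y else zero_tangent))"
      if "finite A" "A \<subseteq> \<V>" for A
      using that
    proof (induction A)
      case empty
      show ?case
        using T_comb[OF \<delta>y \<delta>y, of 0 0]
        by (intro bexI[of _ "tuple_comb D 0 \<delta>y 0 \<delta>y"]) (auto simp: lagrangian_form_comb constraint_form_comb)
    next
      case (insert \<alpha> A)
      then obtain X where X: "X \<in> T" "lagrangian_form X = (\<Sum>\<alpha>\<in>A. lagrangian_form (?s \<alpha>))"
        "\<forall>\<beta>\<in>\<V>. constraint_form \<beta> X = (if \<beta> \<in> A then constraint_form \<beta> \<delta>y else zero_tangent)"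
        by auto
      have \<alpha>: "\<alpha> \<in> \<V>" using insert by simp
      show ?case
        using X T_comb[OF X(1) s(1)[OF mem[OF \<alpha>]]] insert s(2)[OF mem[OF \<alpha>]]
        by (intro bexI[of _ "tuple_comb D 1 X 1 (?s \<alpha>)"])
          (auto simp: lagrangian_form_comb constraint_form_comb single_def)
    qed
    from this[OF finite_domain order_refl] obtain X where
      X: "X \<in> T" "lagrangian_form X = (\<Sum>\<alpha>\<in>\<V>. lagrangian_form (?s \<alpha>))"
      "\<And>\<beta>. \<beta> \<in> \<V> \<Longrightarrow> constraint_form \<beta> X = constraint_form \<beta> \<delta>y"
      by auto
    have "lagrangian_form \<delta>y = (\<Sum>\<alpha>\<in>\<V>. lagrangian_form (?s \<alpha>))"
      using factor[OF X(1) \<delta>y X(3)] X(2) by simp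
    then show ?thesis
      using mem by (simp add: extended_form_def lam_def sum_negf)
  qed
  ultimately show ?thesis
    using that extended_form_vanishes_iff by blast
qed

lemma multiplier_of_eq:
  assumes "lam \<in> multipliers G \<V>" "euler_lagrange_equations lam"
  shows "multiplier_of C Y \<L> G \<Phi> \<V> y = lam"
  unfolding multiplier_of_def
  by (rule the_equality)
    (use assms multiplier_unique in \<open>auto simp: euler_lagrange_equations_def\<close>)

section \<open>The equivalence of the two problems\<close>

lemma critical_for_action_form_iff:
  assumes lam: "lam \<in> multipliers G \<V>"
  shows "critical_for_action_form C Y \<L> G \<Phi> \<V> (y, lam) \<longleftrightarrow> (\<forall>\<delta>y\<in>T. extended_form lam \<delta>y = 0)"
  \<comment> \<open>The quantifier over \<open>\<delta>lam\<close> ranges over a nonempty set, as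
    \<open>lam\<close> itself belongs to it.\<close>
  using lam admissible by (auto simp: critical_for_action_form_def action_form_eq)

lemma critical_for_action_form_iff_multiplier:
  assumes lam: "lam \<in> multipliers G \<V>"
  shows "critical_for_action_form C Y \<L> G \<Phi> \<V> (y, lam) \<longleftrightarrow>
    critical_section C Y \<L> G \<Phi> \<V> y \<and> lam = multiplier_of C Y \<L> G \<Phi> \<V> y"
proof
  assume "critical_for_action_form C Y \<L> G \<Phi> \<V> (y, lam)"
  then have crit: "\<forall>\<delta>y\<in>T. extended_form lam \<delta>y = 0"
    using critical_for_action_form_iff[OF lam] by simp
  then have "lam = multiplier_of C Y \<L> G \<Phi> \<V> y"
    using multiplier_of_eq extended_form_vanishes_iff lam by simp
  moreover have "critical_section C Y \<L> G \<Phi> \<V> y"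
    unfolding critical_section_iff
  proof (intro ballI impI)
    fix \<delta>y assume "\<delta>y \<in> T" "\<forall>\<alpha>\<in>\<V>. constraint_form \<alpha> \<delta>y = zero_tangent"
    then show "lagrangian_form \<delta>y = 0"
      using crit dual_space_zero[OF multiplier_dual[OF lam] zero_in_lie_algebra]
      by (auto simp: extended_form_def)
  qed
  ultimately show "critical_section C Y \<L> G \<Phi> \<V> y \<and> lam = multiplier_of C Y \<L> G \<Phi> \<V> y" by simp
next
  assume *: "critical_section C Y \<L> G \<Phi> \<V> y \<and> lam = multiplier_of C Y \<L> G \<Phi> \<V> y"
  \<comment> \<open>\<open>multiplier_of\<close> is a definite description, so existence must be
    known before the equation for \<open>lam\<close> carries information.\<close>
  then obtain \<mu> where "\<mu> \<in> multipliers G \<V>" "euler_lagrange_equations \<mu>"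
    using multiplier_exists by blast
  then have "euler_lagrange_equations lam"
    using * multiplier_of_eq by simp
  then show "critical_for_action_form C Y \<L> G \<Phi> \<V> (y, lam)"
    using critical_for_action_form_iff[OF lam] extended_form_vanishes_iff[OF lam] by simp
qed

end

theorem theorem3p5:
  fixes C :: "'c cell_complex"
    and \<V> :: "'c set"
    and m :: nat
    and Y :: "'c \<Rightarrow> ('y, 'i) manifold"
    and \<L> :: "'c \<Rightarrow> ('c \<Rightarrow> 'y) \<Rightarrow> real"
    and G :: "('g, 'j) lie_group"
    and \<Phi> :: "'c \<Rightarrow> ('c \<Rightarrow> 'y) \<Rightarrow> 'g"
    and y :: "'c \<Rightarrow> 'y"
    and lam :: "'c \<Rightarrow> 'g tangent \<Rightarrow> real"
  assumes "abstract_cellular_complex C"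
    and "\<And>\<alpha>. \<alpha> \<in> faces C \<Longrightarrow> finite (face_vertices C \<alpha>)"
    and "finite \<V>" and "\<V> \<subseteq> faces C"
    and "\<And>v. v \<in> vertices C \<Longrightarrow> smooth_manifold (Y v) \<and> mdim (Y v) = m"
    and "\<And>\<alpha>. \<alpha> \<in> faces C \<Longrightarrow> smooth_fun (J1 C Y \<alpha>) (\<L> \<alpha>)"
    and "lie_group G"
    and "\<And>\<alpha>. \<alpha> \<in> faces C \<Longrightarrow> smooth_map (J1 C Y \<alpha>) (mfd G) (\<Phi> \<alpha>)"
    and "\<And>\<alpha>. \<alpha> \<in> faces C \<Longrightarrow> regular_value (J1 C Y \<alpha>) (mfd G) (\<Phi> \<alpha>) \<one>\<^bsub>G\<^esub>"
    and "y \<in> points (sections C Y \<V>)" and "lam \<in> multipliers G \<V>"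
    and "admissible_section C Y G \<Phi> \<V> y" and "regular_section C Y G \<Phi> \<V> y"
  shows "critical_for_action_form C Y \<L> G \<Phi> \<V> (y, lam) \<longleftrightarrow>
    admissible_section C Y G \<Phi> \<V> y \<and> regular_section C Y G \<Phi> \<V> y \<and>
    critical_section C Y \<L> G \<Phi> \<V> y \<and> lam = multiplier_of C Y \<L> G \<Phi> \<V> y"
proof -
  interpret regular_admissible_section C \<V> Y \<L> G \<Phi> y
    using assms by unfold_locales auto
  show ?thesis
    using critical_for_action_form_iff_multiplier assms by blast
qed

end
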